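(* There are constants $A_p\ge0$, $p\ge2$, where $A_p$ depends only on $p$, such that the following holds. Let $N\in\mathbb{N}$, let $(a_{i,j})_{i,j\in[N]}$ and $(b_i)_{i\in[N]}$ be deterministic complex numbers, and let $(Y_i)_{i\in[N]}$ and $(Z_i)_{i\in[N]}$ be complex-valued random variables with common expectation $m^{(1)}\in\mathbb{C}$ such that the whole family $\mathcal{W}=\{Y_i: i\in[N]\}\cup\{Z_i: i\in[N]\}$ is independent. Assume that for all $p\ge2$ there is $\mu_p\ge0$ such that $\|W-m^{(1)}\|_p\le\mu_p$ for all $W\in\mathcal{W}$. Then for all $p\ge2$: (i) $\displaystyle\Big\|\sum_{i\in[N]}b_iY_i\Big\|_p\le\Big(A_p\mu_p+\sqrt N\,|m^{(1)}|\Big)\sqrt{\sum_{i\in[N]}|b_i|^2}$; (ii) $\displaystyle\Big\|\sum_{i,j\in[N]}a_{i,j}Y_iZ_j\Big\|_p\le\Big(A_p^2\mu_p^2+2A_p\mu_p\sqrt N\,|m^{(1)}|+N|m^{(1)}|^2\Big)\sqrt{\sum_{i,j\in[N]}|a_{i,j}|^2}$; (iii) $\displaystyle\Big\|\sum_{i\ne j\in[N]}a_{i,j}Y_iY_j\Big\|_p\le\Big(4A_p^2\mu_p^2+2A_p\mu_p\sqrt N\,|m^{(1)}|+N|m^{(1)}|^2\Big)\sqrt{\sum_{i\ne j\in[N]}|a_{i,j}|^2}$.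
   Context: $[N]=\{1,\dots,N\}$. For a complex random variable $X$, $\|X\|_p=(\mathbb{E}|X|^p)^{1/p}$. Sums over "$i\ne j\in[N]$" run over all ordered pairs $(i,j)\in[N]^2$ with $i\ne j$. *)

theory Defs
  imports "HOL-Probability.Probability"
begin

text \<open>
  The norm \<open>(E |X|^p)^(1/p)\<close> for real \<open>p > 0\<close>, valued in \<open>ennreal\<close> so that an infinite
  moment gives the norm \<open>\<infinity>\<close>; the Bochner integral would return \<open>0\<close> instead. In particular,
  a bound \<open>Lp_norm M p X \<le> ennreal c\<close> includes the finiteness of the \<open>p\<close>-th moment.
\<close>

definition Lp_norm :: "'a measure \<Rightarrow> real \<Rightarrow> ('a \<Rightarrow> complex) \<Rightarrow> ennreal" where
  "Lp_norm M p X =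
     (let I = \<integral>\<^sup>+ \<omega>. ennreal (cmod (X \<omega>) powr p) \<partial>M
      in if I = \<infinity> then \<infinity> else ennreal (enn2real I powr (1 / p)))"

lemma Lp_norm_eq_integral:
  assumes "integrable M (\<lambda>\<omega>. cmod (X \<omega>) powr p)"
  shows "Lp_norm M p X = ennreal ((\<integral>\<omega>. cmod (X \<omega>) powr p \<partial>M) powr (1 / p))"
  using assms by (simp add: Lp_norm_def Let_def nn_integral_eq_integral)

text \<open>
  The families \<open>Y\<close> and \<open>Z\<close> are independent jointly, as one family indexed by the disjoint
  sum of two copies of \<open>{1..N}\<close>. Measurability of all \<open>Y i\<close>, \<open>Z i\<close> is part of
  \<open>prob_space.indep_vars\<close>.
\<close>

definition independent_families ::
  "'a measure \<Rightarrow> nat \<Rightarrow> (nat \<Rightarrow> 'a \<Rightarrow> complex) \<Rightarrow> (nat \<Rightarrow> 'a \<Rightarrow> complex) \<Rightarrow> bool" where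
  "independent_families M N Y Z \<longleftrightarrow>
     prob_space.indep_vars M (\<lambda>_. borel) (case_sum Y Z) ({1..N} <+> {1..N})"

text \<open>
  The type argument is the type of outcomes: \<open>A\<close> gives valid constants for all probability
  spaces on that type. HOL cannot quantify over types inside a formula, so for a free type
  variable \<open>'a\<close> the formula \<open>\<exists>A. moment_constants TYPE('a) A\<close> alone would allow the constants
  to depend on \<open>'a\<close>. Constants that depend only on \<open>p\<close> are expressed by two facts: some \<open>A\<close> is
  valid on one fixed type (\<open>nat \<Rightarrow> complex\<close>, which carries every joint law of countably many
  complex random variables), and any such \<open>A\<close> is valid on every type \<open>'a\<close>.
\<close>

definition moment_constants :: "'a itself \<Rightarrow> (real \<Rightarrow> real) \<Rightarrow> bool" where
  "moment_constants _ A \<longleftrightarrow>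
     (\<forall>p\<ge>2. 0 \<le> A p) \<and>
     (\<forall>(M :: 'a measure) (N :: nat) (a :: nat \<Rightarrow> nat \<Rightarrow> complex) (b :: nat \<Rightarrow> complex)
        (Y :: nat \<Rightarrow> 'a \<Rightarrow> complex) (Z :: nat \<Rightarrow> 'a \<Rightarrow> complex)
        (m :: complex) (\<mu> :: real \<Rightarrow> real).
        prob_space M \<longrightarrow>
        independent_families M N Y Z \<longrightarrow>
        (\<forall>i\<in>{1..N}. has_bochner_integral M (Y i) m \<and> has_bochner_integral M (Z i) m) \<longrightarrow>
        (\<forall>p\<ge>2. 0 \<le> \<mu> p \<and>
           (\<forall>i\<in>{1..N}. Lp_norm M p (\<lambda>\<omega>. Y i \<omega> - m) \<le> ennreal (\<mu> p) \<and>
                       Lp_norm M p (\<lambda>\<omega>. Z i \<omega> - m) \<le> ennreal (\<mu> p))) \<longrightarrow>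
        (\<forall>p\<ge>2.
           Lp_norm M p (\<lambda>\<omega>. \<Sum>i\<in>{1..N}. b i * Y i \<omega>)
             \<le> ennreal ((A p * \<mu> p + sqrt (real N) * cmod m)
                 * sqrt (\<Sum>i\<in>{1..N}. (cmod (b i))\<^sup>2)) \<and>
           Lp_norm M p (\<lambda>\<omega>. \<Sum>(i, j)\<in>{1..N} \<times> {1..N}. a i j * Y i \<omega> * Z j \<omega>)
             \<le> ennreal (((A p)\<^sup>2 * (\<mu> p)\<^sup>2 + 2 * A p * \<mu> p * sqrt (real N) * cmod m
                   + real N * (cmod m)\<^sup>2)
                 * sqrt (\<Sum>(i, j)\<in>{1..N} \<times> {1..N}. (cmod (a i j))\<^sup>2)) \<and>
           Lp_norm M p (\<lambda>\<omega>. \<Sum>(i, j)\<in>{(i, j). i \<in> {1..N} \<and> j \<in> {1..N} \<and> i \<noteq> j}.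
                 a i j * Y i \<omega> * Y j \<omega>)
             \<le> ennreal ((4 * (A p)\<^sup>2 * (\<mu> p)\<^sup>2 + 2 * A p * \<mu> p * sqrt (real N) * cmod m
                   + real N * (cmod m)\<^sup>2)
                 * sqrt (\<Sum>(i, j)\<in>{(i, j). i \<in> {1..N} \<and> j \<in> {1..N} \<and> i \<noteq> j}.
                     (cmod (a i j))\<^sup>2))))"

end

theory Submission
  imports Defs
begin

text \<open>
  All three bounds rest on the \<open>2\<close>-smoothness of the \<open>L\<^sup>p\<close> norm for \<open>p \<ge> 2\<close>: if \<open>D\<close> is
  orthogonal to the gradient \<open>|S|\<^bsup>p-2\<^esup> S\<close> of \<open>|S|\<^bsup>p\<^esup>\<close>, that is, if \<open>E (|S|\<^bsup>p-2\<^esup> \<langle>S, D\<rangle>) = 0\<close>, then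
  \<open>\<parallel>S + D\<parallel>\<^sup>2 \<le> \<parallel>S\<parallel>\<^sup>2 + K \<parallel>D\<parallel>\<^sup>2\<close> with \<open>K\<close> depending only on \<open>p\<close>
  (\<open>Lp_norm_add_orthogonal_le\<close>). It is the integrated form of a pointwise second-order expansion
  of \<open>|s + x|\<^bsup>p\<^esup>\<close> (\<open>norm_add_powr_le\<close>). The orthogonality is automatic for \<open>D = X V\<close> with \<open>X\<close>
  centred and independent of the pair \<open>(S, V)\<close>, and then also \<open>\<parallel>X V\<parallel> = \<parallel>X\<parallel> \<parallel>V\<parallel>\<close>
  (\<open>Lp_norm_add_indep_mult_le\<close>).

  A linear form in centred independent variables, and a quadratic form with zero diagonal, are
  built up one variable at a time: adding the variable \<open>X\<^sub>k\<close> changes the form by \<open>X\<^sub>k V\<close>, where \<open>V\<close>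
  depends only on the variables already present. For a linear form \<open>V\<close> is the coefficient \<open>b\<^sub>k\<close>; for a
  quadratic form it is the linear form \<open>\<Sum>\<^sub>i (a\<^sub>i\<^sub>k + a\<^sub>k\<^sub>i) X\<^sub>i\<close>, which the linear case bounds.
  Adding up the squares gives \<open>\<surd>K \<mu> |b|\<close> and \<open>\<surd>2 K \<mu>\<^sup>2 |a|\<close>.

  For variables with mean \<open>m\<close>, substitute \<open>W\<^sub>i = X\<^sub>i + m\<close> and expand. The terms with a factor \<open>m\<close> are
  linear forms whose coefficients are row or column sums, and a constant; Cauchy-Schwarz gives one factor \<open>\<surd>N\<close>
  for each summation index. Parts (ii) and (iii) are the same bound: both are off-diagonal
  quadratic forms in the joint family \<open>W\<close> of all \<open>Y\<^sub>i\<close> and \<open>Z\<^sub>j\<close>, with at most \<open>N\<close> nonzero entries in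
  each row and column.

  The constants so obtained do not depend on the type of outcomes. That constants valid for
  one sample space carry over to another is seen by replacing the variables by the coordinates
  on \<open>\<complex>\<^sup>\<nat>\<close> under their joint law (\<open>moment_constants_transfer\<close>).
\<close>


section \<open>A pointwise second-order expansion of the p-th power\<close>

text \<open>
  Bernoulli's inequality for real exponents, from Young's inequality applied to
  \<open>t = (t powr q) powr (1/q) * 1 powr (1 - 1/q)\<close>.
\<close>

lemma one_add_mult_le_powr:
  fixes t q :: real
  assumes "0 \<le> t" "1 \<le> q"
  shows "1 + q * (t - 1) \<le> t powr q"
proof (cases "t = 0")
  case False
  then have t: "0 < t" using assms by simp
  have "(t powr q) powr (1/q) * 1 powr (1 - 1/q) \<le> (1/q) * t powr q + (1 - 1/q) * 1"
    using t assms by (intro Youngs_inequality_0) auto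
  then have "t \<le> (1/q) * t powr q + (1 - 1/q)"
    using t assms by (simp add: powr_powr)
  then have "q * t \<le> q * ((1/q) * t powr q + (1 - 1/q))"
    using assms by (intro mult_left_mono) auto
  then show ?thesis using assms by (simp add: algebra_simps)
qed (use assms in auto)

text \<open>
  The tangent of \<open>x powr q\<close> at \<open>t\<close>, evaluated at \<open>1\<close>: Bernoulli's inequality for \<open>1 / t\<close>.
\<close>

lemma powr_sub_one_le:
  fixes t q :: real
  assumes "0 < t" "1 \<le> q"
  shows "t powr q - 1 \<le> q * (t powr (q - 1) * (t - 1))"
proof -
  have "1 + q * (1/t - 1) \<le> (1/t) powr q"
    using assms by (intro one_add_mult_le_powr) auto
  then have "t powr q * (1 + q * (1/t - 1)) \<le> t powr q * (1/t) powr q"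
    by (intro mult_left_mono) auto
  also have "\<dots> = 1" using assms by (simp flip: powr_mult)
  finally have "t powr q * (1 + q * (1/t - 1)) \<le> 1" .
  moreover have "t powr q * (1 + q * (1/t - 1)) = t powr q - q * (t powr (q - 1) * (t - 1))"
    using assms by (simp add: powr_diff field_simps)
  ultimately show ?thesis by simp
qed

text \<open>
  The Taylor remainder is controlled without second derivatives, which are unbounded at \<open>0\<close> for
  \<open>1 < q < 2\<close>. By the tangent inequality it is at most
  \<open>q * (t powr (q - 1) - 1) * (t - 1)\<close>, and \<open>t powr (q - 1)\<close> differs from \<open>1\<close> by at
  most a multiple of \<open>\<bar>t - 1\<bar>\<close>. The range up to \<open>4\<close> is what \<open>t = |s + x|\<^sup>2 / |s|\<^sup>2\<close>
  takes for \<open>|x| \<le> |s|\<close>.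
\<close>

lemma powr_le_quadratic:
  fixes t q :: real
  assumes "0 \<le> t" "t \<le> 4" "1 \<le> q"
  shows "t powr q \<le> 1 + q * (t - 1) + q\<^sup>2 * 4 powr q * (t - 1)\<^sup>2"
proof (cases "t = 0")
  case True
  have "q * 1 \<le> q * (q * 4 powr q)"
    using assms mult_mono[of 1 q 1 "4 powr q"] ge_one_powr_ge_zero[of 4 q]
    by (intro mult_left_mono) auto
  then have "q \<le> q * q * 4 powr q" by (simp add: mult.assoc)
  then have "0 \<le> 1 - q + q\<^sup>2 * 4 powr q" by (simp only: power2_eq_square)
  then show ?thesis using True assms by simp
next
  case False
  then have t: "0 < t" using assms by simp
  have q4: "1 \<le> 4 powr q" using assms by (intro ge_one_powr_ge_zero) auto
  define L where "L = q * 4 powr q"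
  have qL: "q \<le> L" unfolding L_def using assms q4 by simp
  have lip: "(t powr (q - 1) - 1) * (t - 1) \<le> L * (t - 1)\<^sup>2"
  proof (cases "1 \<le> t")
    case True
    have "t powr (q - 1) - 1 \<le> t powr q - 1" using True by (simp add: powr_mono)
    also have "\<dots> \<le> q * (t powr (q - 1) * (t - 1))" by (rule powr_sub_one_le[OF t assms(3)])
    also have "\<dots> \<le> q * (4 powr q * (t - 1))"
    proof -
      have "t powr (q - 1) \<le> t powr q" using True by (simp add: powr_mono)
      also have "\<dots> \<le> 4 powr q" using assms by (intro powr_mono2) auto
      finally show ?thesis using True assms by (intro mult_left_mono mult_right_mono) auto
    qed
    finally have "t powr (q - 1) - 1 \<le> L * (t - 1)" by (simp add: L_def)
    then have "(t powr (q - 1) - 1) * (t - 1) \<le> L * (t - 1) * (t - 1)"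
      using True by (intro mult_right_mono) auto
    then show ?thesis by (simp add: power2_eq_square algebra_simps)
  next
    case False
    have "1 + q * (t - 1) \<le> t powr q" using assms by (intro one_add_mult_le_powr) auto
    also have "\<dots> \<le> t powr (q - 1)" using False t by (intro powr_mono') auto
    finally have "1 - t powr (q - 1) \<le> q * (1 - t)" by (simp add: algebra_simps)
    also have "\<dots> \<le> L * (1 - t)" using False qL by (intro mult_right_mono) auto
    finally have "(1 - t powr (q - 1)) * (1 - t) \<le> L * (1 - t) * (1 - t)"
      using False by (intro mult_right_mono) auto
    then show ?thesis by (simp add: power2_eq_square algebra_simps)
  qed
  have "t powr q - 1 - q * (t - 1) \<le> q * ((t powr (q - 1) - 1) * (t - 1))"
    using powr_sub_one_le[OF t assms(3)] by (simp add: algebra_simps)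
  also have "\<dots> \<le> q * (L * (t - 1)\<^sup>2)" using lip assms by (intro mult_left_mono) auto
  finally show ?thesis by (simp add: L_def power2_eq_square algebra_simps)
qed

text \<open>
  Large enough for both regimes of the next inequality: \<open>|x| \<le> |s|\<close> needs
  \<open>p/2 + 9 * (p/2)\<^sup>2 * 2 powr p\<close>, and \<open>|x| > |s|\<close> needs \<open>2 powr p + p\<close>.
\<close>

definition smooth_const :: "real \<Rightarrow> real" where
  "smooth_const p = p + 9 * p\<^sup>2 * 2 powr p"

lemma smooth_const_ge_one:
  assumes "2 \<le> p"
  shows "1 \<le> smooth_const p"
  unfolding smooth_const_def using assms by (simp add: add_increasing2)

text \<open>
  The linear term is the derivative of \<open>|s|\<^bsup>p\<^esup>\<close> in direction \<open>x\<close>; this is the term that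
  vanishes after taking expectations. For \<open>|x| \<le> |s|\<close> the bound is the quadratic bound for
  \<open>t powr (p/2)\<close> at \<open>t = |s + x|\<^sup>2 / |s|\<^sup>2\<close>; for \<open>|x| > |s|\<close> every term is at most a multiple
  of \<open>|x|\<^bsup>p\<^esup>\<close>.
\<close>

lemma norm_add_powr_le:
  fixes s x :: complex
  assumes p: "2 \<le> p"
  shows "cmod (s + x) powr p \<le> cmod s powr p + p * (cmod s powr (p - 2) * (s \<bullet> x))
    + smooth_const p * (cmod s powr (p - 2) * (cmod x)\<^sup>2 + cmod x powr p)"
proof -
  define u r where "u = cmod s" and "r = cmod x"
  define C where "C = smooth_const p"
  have u0: "0 \<le> u" and r0: "0 \<le> r" by (auto simp: u_def r_def)
  have C0: "0 \<le> C" using smooth_const_ge_one[OF p] by (simp add: C_def)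
  have inn: "\<bar>s \<bullet> x\<bar> \<le> u * r" unfolding u_def r_def by (rule Cauchy_Schwarz_ineq2)
  have up: "u powr (p - 2) * u\<^sup>2 = u powr p"
  proof (cases "u = 0")
    case False
    then have "u\<^sup>2 = u powr 2" using u0 by simp
    then show ?thesis by (simp only: flip: powr_add) simp
  qed (use p in auto)
  show ?thesis
  proof (cases "r \<le> u")
    case True
    show ?thesis
    proof (cases "u = 0")
      case True
      then show ?thesis using \<open>r \<le> u\<close> r0 unfolding u_def r_def by auto
    next
      case False
      then have u: "0 < u" using u0 by simp
      define t where "t = (cmod (s + x) / u)\<^sup>2"
      define h where "h = (2 * (s \<bullet> x) + r\<^sup>2) / u\<^sup>2"
      have sq: "(cmod (s + x))\<^sup>2 = u\<^sup>2 + 2 * (s \<bullet> x) + r\<^sup>2"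
        unfolding u_def r_def power2_norm_eq_inner by (simp add: inner_add_left inner_add_right inner_commute)
      have t1: "t = 1 + h"
        using u unfolding t_def h_def power_divide sq by (simp add: field_simps)
      have "cmod (s + x) \<le> 2 * u"
        using norm_triangle_ineq[of s x] True unfolding u_def r_def by simp
      then have "cmod (s + x) / u \<le> 2" using u by (simp add: field_simps)
      then have "t \<le> 2\<^sup>2" unfolding t_def using u by (intro power_mono) auto
      then have t4: "t \<le> 4" by simp
      have t0: "0 \<le> t" by (simp add: t_def)
      have "\<bar>2 * (s \<bullet> x) + r\<^sup>2\<bar> \<le> 3 * (u * r)"
      proof -
        have "r\<^sup>2 \<le> u * r" using True r0 by (simp add: power2_eq_square mult_right_mono)
        moreover have "0 \<le> r\<^sup>2" by simp
        ultimately show ?thesis using inn by linarith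
      qed
      then have "(2 * (s \<bullet> x) + r\<^sup>2)\<^sup>2 \<le> (3 * (u * r))\<^sup>2"
        using abs_le_square_iff[of "2 * (s \<bullet> x) + r\<^sup>2" "3 * (u * r)"] u r0 by simp
      then have "h\<^sup>2 \<le> (3 * (u * r))\<^sup>2 / (u\<^sup>2)\<^sup>2"
        unfolding h_def power_divide by (intro divide_right_mono) auto
      also have "\<dots> = 9 * (r\<^sup>2 / u\<^sup>2)"
        using u by (simp add: field_simps power2_eq_square)
      finally have h2: "h\<^sup>2 \<le> 9 * (r\<^sup>2 / u\<^sup>2)" .
      have "cmod (s + x) powr p = u powr p * t powr (p / 2)"
      proof -
        have "t powr (p/2) = (cmod (s + x) / u) powr p"
        proof (cases "cmod (s + x) = 0")
          case False
          then have pos: "0 < cmod (s + x) / u" using u by simp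
          then have "t = (cmod (s + x) / u) powr 2" by (simp add: t_def)
          then show ?thesis by (simp add: powr_powr)
        qed (simp add: t_def)
        then show ?thesis using u by (simp add: powr_divide)
      qed
      also have "\<dots> \<le> u powr p * (1 + p/2 * (t - 1) + (p/2)\<^sup>2 * 4 powr (p/2) * (t - 1)\<^sup>2)"
        using t0 t4 p by (intro mult_left_mono powr_le_quadratic) auto
      also have "\<dots> \<le> u powr p * (1 + p/2 * h + (p/2)\<^sup>2 * 2 powr p * (9 * (r\<^sup>2 / u\<^sup>2)))"
      proof -
        have "(4::real) = 2 powr 2" by simp
        then have "(4::real) powr (p/2) = 2 powr p" by (simp only: powr_powr) simp
        then have "(p/2)\<^sup>2 * 4 powr (p/2) * (t - 1)\<^sup>2 \<le> (p/2)\<^sup>2 * 2 powr p * (9 * (r\<^sup>2 / u\<^sup>2))"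
          using mult_left_mono[OF h2, of "(p/2)\<^sup>2 * 2 powr p"] t1 by simp
        then show ?thesis using t1 p by (intro mult_left_mono add_mono) auto
      qed
      also have "\<dots> = u powr p + p * (u powr (p - 2) * (s \<bullet> x))
          + (p/2 + 9/4 * p\<^sup>2 * 2 powr p) * (u powr (p - 2) * r\<^sup>2)"
        unfolding up[symmetric] h_def using u by (simp add: field_simps power2_eq_square)
      also have "\<dots> \<le> u powr p + p * (u powr (p - 2) * (s \<bullet> x)) + C * (u powr (p - 2) * r\<^sup>2 + r powr p)"
      proof -
        have "(p/2 + 9/4 * p\<^sup>2 * 2 powr p) * (u powr (p - 2) * r\<^sup>2) \<le> C * (u powr (p - 2) * r\<^sup>2)"
          unfolding C_def smooth_const_def using p by (intro mult_right_mono add_mono) auto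
        also have "\<dots> \<le> C * (u powr (p - 2) * r\<^sup>2 + r powr p)"
          using C0 by (intro mult_left_mono) auto
        finally show ?thesis by simp
      qed
      finally show ?thesis by (simp add: u_def r_def C_def)
    qed
  next
    case False
    then have r: "0 < r" "u \<le> r" using u0 by auto
    have "cmod (s + x) \<le> 2 * r"
      using norm_triangle_ineq[of s x] False unfolding u_def r_def by simp
    then have "cmod (s + x) powr p \<le> (2 * r) powr p" using p by (intro powr_mono2) auto
    also have "\<dots> = 2 powr p * r powr p" using r by (simp add: powr_mult)
    finally have 1: "cmod (s + x) powr p \<le> 2 powr p * r powr p" .
    have "u powr (p - 2) * \<bar>s \<bullet> x\<bar> \<le> r powr (p - 2) * r\<^sup>2"
    proof (intro mult_mono)
      show "u powr (p - 2) \<le> r powr (p - 2)" using u0 r p by (intro powr_mono2) auto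
      show "\<bar>s \<bullet> x\<bar> \<le> r\<^sup>2" using inn r by (smt (verit) mult_right_mono power2_eq_square)
    qed auto
    also have "\<dots> = r powr p" using r by (simp add: powr_diff)
    finally have "\<bar>u powr (p - 2) * (s \<bullet> x)\<bar> \<le> r powr p" by (simp add: abs_mult)
    then have "- (r powr p) \<le> u powr (p - 2) * (s \<bullet> x)" by linarith
    then have "p * - (r powr p) \<le> p * (u powr (p - 2) * (s \<bullet> x))"
      using p by (intro mult_left_mono) auto
    then have 2: "0 \<le> p * (u powr (p - 2) * (s \<bullet> x)) + p * r powr p" by simp
    have "(2 powr p + p) * r powr p \<le> C * r powr p"
    proof (intro mult_right_mono)
      have "1 * 2 powr p \<le> (9 * p\<^sup>2) * 2 powr p"
        using p power_mono[of 2 p 2] by (intro mult_right_mono) auto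
      then show "2 powr p + p \<le> C" by (simp add: C_def smooth_const_def)
    qed auto
    then have 3: "2 powr p * r powr p + p * r powr p \<le> C * r powr p" by (simp add: algebra_simps)
    have 4: "C * r powr p \<le> C * (u powr (p - 2) * r\<^sup>2 + r powr p)"
      using C0 by (intro mult_left_mono) auto
    have "0 \<le> u powr p" by simp
    with 1 2 3 4 show ?thesis unfolding u_def[symmetric] r_def[symmetric] C_def[symmetric] by linarith
  qed
qed

text \<open>
  Converts the bound for \<open>p\<close>-th moments into one for squared norms. With \<open>w\<close> the square root on
  the right, \<open>w powr p = w\<^sup>2 * w powr (p - 2)\<close>; of the two copies of \<open>C * d\<^sup>2\<close> in \<open>w\<^sup>2\<close>, one
  uses \<open>w \<ge> s\<close> and the other \<open>w \<ge> d\<close>.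
\<close>

lemma powr_add_le_sum_squares_powr:
  fixes s d C p :: real
  assumes "2 \<le> p" "1 \<le> C" "0 < s" "0 < d"
  shows "s powr p + C * (s powr (p - 2) * d\<^sup>2 + d powr p) \<le> (sqrt (s\<^sup>2 + 2 * C * d\<^sup>2)) powr p"
proof -
  define w where "w = sqrt (s\<^sup>2 + 2 * C * d\<^sup>2)"
  have sq: "x\<^sup>2 * x powr (p - 2) = x powr p" if "0 < x" for x :: real
    using that by (simp add: powr_diff)
  have "1 * d\<^sup>2 \<le> 2 * C * d\<^sup>2" using assms by (intro mult_right_mono) auto
  then have "s\<^sup>2 \<le> s\<^sup>2 + 2 * C * d\<^sup>2" "d\<^sup>2 \<le> s\<^sup>2 + 2 * C * d\<^sup>2"
    using zero_le_power2[of s] zero_le_power2[of d] by linarith+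
  then have sw: "s \<le> w" and dw: "d \<le> w"
    unfolding w_def using assms by (auto intro: real_le_rsqrt)
  have w: "0 < w" using sw assms by simp
  have w2: "w\<^sup>2 = s\<^sup>2 + C * d\<^sup>2 + C * d\<^sup>2"
    unfolding w_def using assms by simp
  have "s powr p + C * (s powr (p - 2) * d\<^sup>2 + d powr p)
      = s\<^sup>2 * s powr (p - 2) + C * d\<^sup>2 * s powr (p - 2) + C * d\<^sup>2 * d powr (p - 2)"
    using assms by (simp flip: sq add: algebra_simps)
  also have "\<dots> \<le> s\<^sup>2 * w powr (p - 2) + C * d\<^sup>2 * w powr (p - 2) + C * d\<^sup>2 * w powr (p - 2)"
    using sw dw assms by (intro add_mono mult_left_mono powr_mono2) auto
  also have "\<dots> = w\<^sup>2 * w powr (p - 2)" by (simp add: w2 algebra_simps)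
  also have "\<dots> = w powr p" by (rule sq[OF w])
  finally show ?thesis by (simp add: w_def)
qed

section \<open>Bounds for Lp norms\<close>

lemma Lp_norm_le_iff_nn_integral:
  assumes "0 < p" "0 \<le> c"
  shows "Lp_norm M p X \<le> ennreal c
    \<longleftrightarrow> (\<integral>\<^sup>+ \<omega>. ennreal (cmod (X \<omega>) powr p) \<partial>M) \<le> ennreal (c powr p)"
proof (cases "\<integral>\<^sup>+ \<omega>. ennreal (cmod (X \<omega>) powr p) \<partial>M")
  case top
  then show ?thesis by (simp add: Lp_norm_def Let_def top_unique)
next
  case (real r)
  have "r powr (1/p) \<le> c \<longleftrightarrow> r \<le> c powr p"
  proof
    assume "r powr (1/p) \<le> c"
    then have "(r powr (1/p)) powr p \<le> c powr p" using assms by (intro powr_mono2) auto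
    then show "r \<le> c powr p" using assms real by (simp add: powr_powr)
  next
    assume "r \<le> c powr p"
    then have "r powr (1/p) \<le> (c powr p) powr (1/p)" using assms real by (intro powr_mono2) auto
    then show "r powr (1/p) \<le> c" using assms by (simp add: powr_powr)
  qed
  then show ?thesis using real assms by (simp add: Lp_norm_def Let_def)
qed

lemma Lp_norm_le_iff_integral:
  assumes "0 < p" "0 \<le> c" "X \<in> borel_measurable M"
  shows "Lp_norm M p X \<le> ennreal c \<longleftrightarrow>
    integrable M (\<lambda>\<omega>. cmod (X \<omega>) powr p) \<and> (\<integral>\<omega>. cmod (X \<omega>) powr p \<partial>M) \<le> c powr p"
proof
  assume "Lp_norm M p X \<le> ennreal c"
  then have le: "(\<integral>\<^sup>+ \<omega>. ennreal (cmod (X \<omega>) powr p) \<partial>M) \<le> ennreal (c powr p)"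
    using assms by (simp add: Lp_norm_le_iff_nn_integral)
  then have "(\<integral>\<^sup>+ \<omega>. ennreal (cmod (X \<omega>) powr p) \<partial>M) < \<infinity>"
    by (simp add: order_le_less_trans)
  then have "integrable M (\<lambda>\<omega>. cmod (X \<omega>) powr p)"
    using assms by (intro integrableI_nonneg) auto
  with le show "integrable M (\<lambda>\<omega>. cmod (X \<omega>) powr p) \<and> (\<integral>\<omega>. cmod (X \<omega>) powr p \<partial>M) \<le> c powr p"
    by (simp add: nn_integral_eq_integral)
next
  assume "integrable M (\<lambda>\<omega>. cmod (X \<omega>) powr p) \<and> (\<integral>\<omega>. cmod (X \<omega>) powr p \<partial>M) \<le> c powr p"
  then show "Lp_norm M p X \<le> ennreal c"
    using assms by (simp add: Lp_norm_le_iff_nn_integral nn_integral_eq_integral)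
qed

text \<open>
  Norm bounds that divide by the bounds of the summands are proved for positive bounds and
  extended to zero by this limit.
\<close>

lemma ennreal_le_at_right_limit:
  fixes f :: "real \<Rightarrow> real" and x :: ennreal
  assumes "(f \<longlongrightarrow> c) (at_right 0)" "\<And>e. 0 < e \<Longrightarrow> x \<le> ennreal (f e)"
  shows "x \<le> ennreal c"
proof (rule tendsto_lowerbound)
  show "((\<lambda>e. ennreal (f e)) \<longlongrightarrow> ennreal c) (at_right 0)" using assms(1) by (rule tendsto_ennrealI)
  show "\<forall>\<^sub>F e in at_right 0. x \<le> ennreal (f e)"
    unfolding eventually_at_right_field using assms(2) by (auto intro: exI[of _ 1])
qed simp

text \<open>
  Convexity of the \<open>p\<close>-th power at the point \<open>(x + y) / (a + b)\<close>, which is the average of \<open>x / a\<close>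
  and \<open>y / b\<close> with weights \<open>a / (a + b)\<close> and \<open>b / (a + b)\<close>. Integrating it proves Minkowski's
  inequality.
\<close>

lemma powr_add_le_weighted:
  fixes a b x y p :: real
  assumes "1 \<le> p" "0 < a" "0 < b" "0 \<le> x" "0 \<le> y"
  shows "(x + y) powr p
    \<le> (a + b) powr p * (a / (a + b) * (x powr p / a powr p) + b / (a + b) * (y powr p / b powr p))"
proof -
  define u where "u = b / (a + b)"
  have u: "0 \<le> u" "u \<le> 1" "1 - u = a / (a + b)" using assms by (auto simp: u_def field_simps)
  have conv: "((1 - u) * s + u * t) powr p \<le> (1 - u) * s powr p + u * t powr p"
    if st: "0 \<le> s" "0 \<le> t" for s t
  proof -
    have less: "v powr p \<le> v" if "0 \<le> v" "v \<le> 1" for v :: real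
      using that assms powr_mono'[of 1 p v] by simp
    consider "s = 0" | "t = 0" | "0 < s" "0 < t" using st by linarith
    then show ?thesis
    proof cases
      case 1
      then show ?thesis using less[of u] u(1,2) st by (simp add: powr_mult mult_right_mono)
    next
      case 2
      then show ?thesis using less[of "1 - u"] u(1,2) st by (simp add: powr_mult mult_right_mono)
    next
      case 3
      then show ?thesis using convex_onD[OF powr_convex[OF assms(1)], of u s t] u by simp
    qed
  qed
  have "x + y = (a + b) * ((1 - u) * (x / a) + u * (y / b))"
  proof -
    have "a + b \<noteq> 0" using assms by simp
    then have "(a + b) * (a / (a + b) * (x / a)) = x" "(a + b) * (b / (a + b) * (y / b)) = y"
      using assms by simp_all
    then show ?thesis unfolding u(3) unfolding u_def by (simp only: distrib_left)
  qed
  then have "(x + y) powr p = (a + b) powr p * ((1 - u) * (x / a) + u * (y / b)) powr p"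
    using assms u by (simp add: powr_mult)
  also have "\<dots> \<le> (a + b) powr p * ((1 - u) * (x / a) powr p + u * (y / b) powr p)"
    using assms by (intro mult_left_mono conv) auto
  finally show ?thesis
    unfolding u(3) unfolding u_def using assms by (simp add: powr_divide)
qed

lemma Lp_norm_add_le:
  assumes p: "1 \<le> p" and [measurable]: "X \<in> borel_measurable M" "Y \<in> borel_measurable M"
    and X: "Lp_norm M p X \<le> ennreal a" "0 \<le> a" and Y: "Lp_norm M p Y \<le> ennreal b" "0 \<le> b"
  shows "Lp_norm M p (\<lambda>\<omega>. X \<omega> + Y \<omega>) \<le> ennreal (a + b)"
proof (rule ennreal_le_at_right_limit)
  show "((\<lambda>e. (a + e) + (b + e)) \<longlongrightarrow> a + b) (at_right 0)"
    by (auto intro!: tendsto_eq_intros)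
next
  fix e :: real assume e: "0 < e"
  define a' b' where "a' = a + e" and "b' = b + e"
  have pos: "0 < a'" "0 < b'" using X Y e by (auto simp: a'_def b'_def)
  have "Lp_norm M p X \<le> ennreal a'" "Lp_norm M p Y \<le> ennreal b'"
    using X Y e by (auto simp: a'_def b'_def add_increasing2)
  then have iX: "integrable M (\<lambda>\<omega>. cmod (X \<omega>) powr p)" and lX: "(\<integral>\<omega>. cmod (X \<omega>) powr p \<partial>M) \<le> a' powr p"
    and iY: "integrable M (\<lambda>\<omega>. cmod (Y \<omega>) powr p)" and lY: "(\<integral>\<omega>. cmod (Y \<omega>) powr p \<partial>M) \<le> b' powr p"
    using p pos by (auto simp: Lp_norm_le_iff_integral)
  define g where "g \<omega> = (a' + b') powr p * (a' / (a' + b') * (cmod (X \<omega>) powr p / a' powr p)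
    + b' / (a' + b') * (cmod (Y \<omega>) powr p / b' powr p))" for \<omega>
  have ig: "integrable M g" unfolding g_def using iX iY by auto
  have le: "cmod (X \<omega> + Y \<omega>) powr p \<le> g \<omega>" for \<omega>
  proof -
    have "cmod (X \<omega> + Y \<omega>) powr p \<le> (cmod (X \<omega>) + cmod (Y \<omega>)) powr p"
      using p by (intro powr_mono2 norm_triangle_ineq) auto
    also have "\<dots> \<le> g \<omega>" unfolding g_def using p pos by (intro powr_add_le_weighted) auto
    finally show ?thesis .
  qed
  have "integrable M (\<lambda>\<omega>. cmod (X \<omega> + Y \<omega>) powr p)"
    by (rule Bochner_Integration.integrable_bound[OF ig]) (use le in \<open>auto intro: order_trans[OF _ abs_ge_self]\<close>)
  moreover have "(\<integral>\<omega>. cmod (X \<omega> + Y \<omega>) powr p \<partial>M) \<le> (\<integral>\<omega>. g \<omega> \<partial>M)"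
    by (intro integral_mono calculation ig le)
  moreover have "(\<integral>\<omega>. g \<omega> \<partial>M) \<le> (a' + b') powr p * (a' / (a' + b') * 1 + b' / (a' + b') * 1)"
  proof -
    have "(\<integral>\<omega>. g \<omega> \<partial>M) = (a' + b') powr p * (a' / (a' + b') * ((\<integral>\<omega>. cmod (X \<omega>) powr p \<partial>M) / a' powr p)
      + b' / (a' + b') * ((\<integral>\<omega>. cmod (Y \<omega>) powr p \<partial>M) / b' powr p))"
      unfolding g_def using iX iY by simp
    also have "\<dots> \<le> (a' + b') powr p * (a' / (a' + b') * 1 + b' / (a' + b') * 1)"
      using pos lX lY by (intro mult_left_mono add_mono) auto
    finally show ?thesis .
  qed
  moreover have "a' / (a' + b') * 1 + b' / (a' + b') * 1 = 1"
    using pos by (simp flip: add_divide_distrib)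
  ultimately show "Lp_norm M p (\<lambda>\<omega>. X \<omega> + Y \<omega>) \<le> ennreal ((a + e) + (b + e))"
    unfolding a'_def[symmetric] b'_def[symmetric] using p pos
    by (subst Lp_norm_le_iff_integral) auto
qed

lemma Lp_norm_cmult_le:
  assumes "0 < p" "X \<in> borel_measurable M" "Lp_norm M p X \<le> ennreal c" "0 \<le> c"
  shows "Lp_norm M p (\<lambda>\<omega>. z * X \<omega>) \<le> ennreal (cmod z * c)"
  using assms
  by (auto simp: Lp_norm_le_iff_integral norm_mult powr_mult intro!: mult_left_mono)

lemma (in prob_space) Lp_norm_const_le:
  assumes "0 < p"
  shows "Lp_norm M p (\<lambda>\<omega>. z) \<le> ennreal (cmod z)"
  using assms by (simp add: Lp_norm_le_iff_integral prob_space)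

text \<open>
  Young's inequality with exponents \<open>p / (p - 2)\<close> and \<open>p / 2\<close>, normalised so that integration
  yields Hoelder's inequality \<open>E (|S|\<^bsup>p-2\<^esup> |D|\<^sup>2) \<le> s\<^bsup>p-2\<^esup> d\<^sup>2\<close> for norm bounds \<open>s\<close> and \<open>d\<close>.
\<close>

lemma powr_mult_square_le_weighted:
  fixes a b s d p :: real
  assumes "2 \<le> p" "0 \<le> a" "0 \<le> b" "0 < s" "0 < d"
  shows "a powr (p - 2) * b\<^sup>2
    \<le> s powr (p - 2) * d\<^sup>2 * ((1 - 2/p) * (a powr p / s powr p) + 2/p * (b powr p / d powr p))"
proof (cases "a = 0 \<or> b = 0")
  case True
  then have "a powr (p - 2) * b\<^sup>2 = 0" by auto
  also have "0 \<le> s powr (p - 2) * d\<^sup>2 * ((1 - 2/p) * (a powr p / s powr p) + 2/p * (b powr p / d powr p))"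
    using assms by (intro mult_nonneg_nonneg add_nonneg_nonneg) auto
  finally show ?thesis .
next
  case False
  then have pos: "0 < a" "0 < b" using assms by auto
  have "((a / s) powr p) powr (1 - 2/p) * ((b / d) powr p) powr (2/p)
      \<le> (1 - 2/p) * (a / s) powr p + 2/p * (b / d) powr p"
    using assms pos by (intro Youngs_inequality_0) auto
  moreover have "((a / s) powr p) powr (1 - 2/p) = (a / s) powr (p - 2)"
    using assms by (simp add: powr_powr right_diff_distrib)
  moreover have "((b / d) powr p) powr (2/p) = (b / d)\<^sup>2"
    using pos assms by (simp add: powr_powr)
  moreover have "(a / s) powr p = a powr p / s powr p" "(b / d) powr p = b powr p / d powr p"
    using pos assms by (simp_all add: powr_divide)
  ultimately have "(a / s) powr (p - 2) * (b / d)\<^sup>2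
      \<le> (1 - 2/p) * (a powr p / s powr p) + 2/p * (b powr p / d powr p)"
    by simp
  then have "s powr (p - 2) * d\<^sup>2 * ((a / s) powr (p - 2) * (b / d)\<^sup>2)
      \<le> s powr (p - 2) * d\<^sup>2 * ((1 - 2/p) * (a powr p / s powr p) + 2/p * (b powr p / d powr p))"
    by (intro mult_left_mono) auto
  then show ?thesis using assms pos by (simp add: powr_divide power_divide)
qed

text \<open>
  Provides integrability of the gradient term \<open>|S|\<^bsup>p-1\<^esup> |D|\<close>.
\<close>

lemma powr_sub_one_mult_le:
  fixes a b p :: real
  assumes "2 \<le> p" "0 \<le> a" "0 \<le> b"
  shows "a powr (p - 2) * (a * b) \<le> a powr p + b powr p"
proof (cases "a = 0 \<or> b = 0")
  case False
  define m where "m = max a b"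
  have m: "0 < m" "a \<le> m" "b \<le> m" using False assms by (auto simp: m_def)
  have "a powr (p - 2) * (a * b) \<le> m powr (p - 2) * (m * m)"
    using m assms by (intro mult_mono powr_mono2) auto
  also have "\<dots> = m powr p" using m by (simp add: powr_diff power2_eq_square)
  also have "\<dots> \<le> a powr p + b powr p" by (auto simp: m_def max_def)
  finally show ?thesis .
qed auto

section \<open>Two-smoothness of the Lp norm\<close>

text \<open>
  Integrating the pointwise expansion removes the linear term, and Hoelder's inequality bounds the
  quadratic one.
\<close>

lemma Lp_norm_add_orthogonal_le:
  assumes p: "2 \<le> p" and [measurable]: "S \<in> borel_measurable M" "D \<in> borel_measurable M"
    and S: "Lp_norm M p S \<le> ennreal s" "0 \<le> s" and D: "Lp_norm M p D \<le> ennreal d" "0 \<le> d"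
    and orth: "(\<integral>\<omega>. cmod (S \<omega>) powr (p - 2) * (S \<omega> \<bullet> D \<omega>) \<partial>M) = 0"
  shows "Lp_norm M p (\<lambda>\<omega>. S \<omega> + D \<omega>) \<le> ennreal (sqrt (s\<^sup>2 + 2 * smooth_const p * d\<^sup>2))"
proof (rule ennreal_le_at_right_limit)
  show "((\<lambda>e. sqrt ((s + e)\<^sup>2 + 2 * smooth_const p * (d + e)\<^sup>2))
      \<longlongrightarrow> sqrt (s\<^sup>2 + 2 * smooth_const p * d\<^sup>2)) (at_right 0)"
    by (auto intro!: tendsto_eq_intros)
next
  fix e :: real assume e: "0 < e"
  define s' d' C where "s' = s + e" and "d' = d + e" and "C = smooth_const p"
  have C: "1 \<le> C" unfolding C_def using p by (rule smooth_const_ge_one)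
  have pos: "0 < s'" "0 < d'" using S D e by (auto simp: s'_def d'_def)
  have "Lp_norm M p S \<le> ennreal s'" "Lp_norm M p D \<le> ennreal d'"
    using S D e by (auto simp: s'_def d'_def add_increasing2)
  then have iS: "integrable M (\<lambda>\<omega>. cmod (S \<omega>) powr p)" and lS: "(\<integral>\<omega>. cmod (S \<omega>) powr p \<partial>M) \<le> s' powr p"
    and iD: "integrable M (\<lambda>\<omega>. cmod (D \<omega>) powr p)" and lD: "(\<integral>\<omega>. cmod (D \<omega>) powr p \<partial>M) \<le> d' powr p"
    using p pos by (auto simp: Lp_norm_le_iff_integral)
  define h where "h \<omega> = s' powr (p - 2) * d'\<^sup>2 * ((1 - 2/p) * (cmod (S \<omega>) powr p / s' powr p)
    + 2/p * (cmod (D \<omega>) powr p / d' powr p))" for \<omega>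
  have ih: "integrable M h" unfolding h_def using iS iD by auto
  have hle: "cmod (S \<omega>) powr (p - 2) * (cmod (D \<omega>))\<^sup>2 \<le> h \<omega>" for \<omega>
    unfolding h_def using p pos by (intro powr_mult_square_le_weighted) auto
  have iSD: "integrable M (\<lambda>\<omega>. cmod (S \<omega>) powr (p - 2) * (cmod (D \<omega>))\<^sup>2)"
    by (rule Bochner_Integration.integrable_bound[OF ih]) (use hle in \<open>auto intro: order_trans[OF _ abs_ge_self]\<close>)
  have "(\<integral>\<omega>. cmod (S \<omega>) powr (p - 2) * (cmod (D \<omega>))\<^sup>2 \<partial>M) \<le> (\<integral>\<omega>. h \<omega> \<partial>M)"
    by (intro integral_mono iSD ih hle)
  also have "\<dots> = s' powr (p - 2) * d'\<^sup>2 * ((1 - 2/p) * ((\<integral>\<omega>. cmod (S \<omega>) powr p \<partial>M) / s' powr p)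
    + 2/p * ((\<integral>\<omega>. cmod (D \<omega>) powr p \<partial>M) / d' powr p))"
    unfolding h_def using iS iD by simp
  also have "\<dots> \<le> s' powr (p - 2) * d'\<^sup>2 * ((1 - 2/p) * 1 + 2/p * 1)"
    using pos lS lD p by (intro mult_left_mono add_mono) auto
  finally have lSD: "(\<integral>\<omega>. cmod (S \<omega>) powr (p - 2) * (cmod (D \<omega>))\<^sup>2 \<partial>M) \<le> s' powr (p - 2) * d'\<^sup>2"
    by simp
  have iin: "integrable M (\<lambda>\<omega>. cmod (S \<omega>) powr (p - 2) * (S \<omega> \<bullet> D \<omega>))"
  proof (rule Bochner_Integration.integrable_bound)
    show "integrable M (\<lambda>\<omega>. cmod (S \<omega>) powr p + cmod (D \<omega>) powr p)" using iS iD by simp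
    have "\<bar>cmod (S \<omega>) powr (p - 2) * (S \<omega> \<bullet> D \<omega>)\<bar> \<le> cmod (S \<omega>) powr p + cmod (D \<omega>) powr p" for \<omega>
    proof -
      have "\<bar>cmod (S \<omega>) powr (p - 2) * (S \<omega> \<bullet> D \<omega>)\<bar> \<le> cmod (S \<omega>) powr (p - 2) * (cmod (S \<omega>) * cmod (D \<omega>))"
        by (simp add: abs_mult Cauchy_Schwarz_ineq2 mult_left_mono)
      also have "\<dots> \<le> cmod (S \<omega>) powr p + cmod (D \<omega>) powr p"
        using p by (intro powr_sub_one_mult_le) auto
      finally show ?thesis .
    qed
    then show "AE \<omega> in M. norm (cmod (S \<omega>) powr (p - 2) * (S \<omega> \<bullet> D \<omega>)) \<le> norm (cmod (S \<omega>) powr p + cmod (D \<omega>) powr p)"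
      by simp
  qed measurable
  define g where "g \<omega> = cmod (S \<omega>) powr p + p * (cmod (S \<omega>) powr (p - 2) * (S \<omega> \<bullet> D \<omega>))
    + C * (cmod (S \<omega>) powr (p - 2) * (cmod (D \<omega>))\<^sup>2 + cmod (D \<omega>) powr p)" for \<omega>
  have ig: "integrable M g" unfolding g_def using iS iD iin iSD by auto
  have le: "cmod (S \<omega> + D \<omega>) powr p \<le> g \<omega>" for \<omega>
    unfolding g_def C_def by (rule norm_add_powr_le[OF p])
  have "integrable M (\<lambda>\<omega>. cmod (S \<omega> + D \<omega>) powr p)"
    by (rule Bochner_Integration.integrable_bound[OF ig]) (use le in \<open>auto intro: order_trans[OF _ abs_ge_self]\<close>)
  moreover have "(\<integral>\<omega>. cmod (S \<omega> + D \<omega>) powr p \<partial>M) \<le> (\<integral>\<omega>. g \<omega> \<partial>M)"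
    by (intro integral_mono calculation ig le)
  moreover have "(\<integral>\<omega>. g \<omega> \<partial>M) = (\<integral>\<omega>. cmod (S \<omega>) powr p \<partial>M)
      + C * ((\<integral>\<omega>. cmod (S \<omega>) powr (p - 2) * (cmod (D \<omega>))\<^sup>2 \<partial>M) + (\<integral>\<omega>. cmod (D \<omega>) powr p \<partial>M))"
    unfolding g_def using iS iD iin iSD orth by simp
  moreover have "\<dots> \<le> s' powr p + C * (s' powr (p - 2) * d'\<^sup>2 + d' powr p)"
    using lS lD lSD C by (intro add_mono mult_left_mono) auto
  moreover have "\<dots> \<le> (sqrt (s'\<^sup>2 + 2 * C * d'\<^sup>2)) powr p"
    using p C pos by (intro powr_add_le_sum_squares_powr) auto
  ultimately show "Lp_norm M p (\<lambda>\<omega>. S \<omega> + D \<omega>)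
      \<le> ennreal (sqrt ((s + e)\<^sup>2 + 2 * smooth_const p * (d + e)\<^sup>2))"
    unfolding s'_def[symmetric] d'_def[symmetric] C_def[symmetric] using p C pos
    by (subst Lp_norm_le_iff_integral) auto
qed

text \<open>
  The gradient term factorises: \<open>X = f U\<close> is multiplied by a function of \<open>W\<close>, so its expectation
  contains the factor \<open>E X = 0\<close>. The form with two random elements \<open>U\<close> and \<open>W\<close> allows \<open>W\<close> to be the
  whole vector of variables on which both \<open>S = g W\<close> and \<open>V = h W\<close> depend.
\<close>

lemma (in prob_space) Lp_norm_add_indep_mult_le:
  fixes f g h :: "'b \<Rightarrow> complex"
  assumes p: "2 \<le> p"
    and ind: "indep_var N\<^sub>1 U N\<^sub>2 W"
    and [measurable]: "f \<in> borel_measurable N\<^sub>1" "g \<in> borel_measurable N\<^sub>2" "h \<in> borel_measurable N\<^sub>2"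
    and X: "integrable M (\<lambda>\<omega>. f (U \<omega>))" "expectation (\<lambda>\<omega>. f (U \<omega>)) = 0"
      "Lp_norm M p (\<lambda>\<omega>. f (U \<omega>)) \<le> ennreal \<mu>" "0 \<le> \<mu>"
    and S: "Lp_norm M p (\<lambda>\<omega>. g (W \<omega>)) \<le> ennreal s" "0 \<le> s"
    and V: "Lp_norm M p (\<lambda>\<omega>. h (W \<omega>)) \<le> ennreal v" "0 \<le> v"
  shows "Lp_norm M p (\<lambda>\<omega>. g (W \<omega>) + f (U \<omega>) * h (W \<omega>))
    \<le> ennreal (sqrt (s\<^sup>2 + 2 * smooth_const p * (\<mu> * v)\<^sup>2))"
proof -
  have [measurable]: "random_variable N\<^sub>1 U" "random_variable N\<^sub>2 W"
    using indep_var_rv1[OF ind] indep_var_rv2[OF ind] by auto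
  have iS: "integrable M (\<lambda>\<omega>. cmod (g (W \<omega>)) powr p)"
    and iV: "integrable M (\<lambda>\<omega>. cmod (h (W \<omega>)) powr p)" and lV: "(\<integral>\<omega>. cmod (h (W \<omega>)) powr p \<partial>M) \<le> v powr p"
    and iX: "integrable M (\<lambda>\<omega>. cmod (f (U \<omega>)) powr p)" and lX: "(\<integral>\<omega>. cmod (f (U \<omega>)) powr p \<partial>M) \<le> \<mu> powr p"
    using p S V X by (auto simp: Lp_norm_le_iff_integral)
  have prod: "Lp_norm M p (\<lambda>\<omega>. f (U \<omega>) * h (W \<omega>)) \<le> ennreal (\<mu> * v)"
  proof -
    have "indep_var borel ((\<lambda>x. cmod (f x) powr p) \<circ> U) borel ((\<lambda>y. cmod (h y) powr p) \<circ> W)"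
      by (rule indep_var_compose[OF ind]) auto
    then have i: "indep_var borel (\<lambda>\<omega>. cmod (f (U \<omega>)) powr p) borel (\<lambda>\<omega>. cmod (h (W \<omega>)) powr p)"
      by (simp add: comp_def)
    have "integrable M (\<lambda>\<omega>. cmod (f (U \<omega>)) powr p * cmod (h (W \<omega>)) powr p)"
      by (rule indep_var_integrable[OF i iX iV])
    moreover have "(\<integral>\<omega>. cmod (f (U \<omega>)) powr p * cmod (h (W \<omega>)) powr p \<partial>M) \<le> \<mu> powr p * v powr p"
      unfolding indep_var_lebesgue_integral[OF i iX iV] using lX lV by (intro mult_mono) auto
    ultimately show ?thesis
      using p X V by (subst Lp_norm_le_iff_integral) (auto simp: norm_mult powr_mult)
  qed
  have orth: "(\<integral>\<omega>. cmod (g (W \<omega>)) powr (p - 2) * (g (W \<omega>) \<bullet> (f (U \<omega>) * h (W \<omega>))) \<partial>M) = 0"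
  proof -
    define F where "F y = complex_of_real (cmod (g y) powr (p - 2)) * cnj (g y) * h y" for y
    have [measurable]: "cnj \<in> borel_measurable borel"
      by (intro borel_measurable_continuous_onI continuous_intros)
    have [measurable]: "F \<in> borel_measurable N\<^sub>2"
      unfolding F_def by measurable
    have "indep_var borel (f \<circ> U) borel (F \<circ> W)"
      by (rule indep_var_compose[OF ind]) auto
    then have i: "indep_var borel (\<lambda>\<omega>. f (U \<omega>)) borel (\<lambda>\<omega>. F (W \<omega>))"
      by (simp add: comp_def)
    have iF: "integrable M (\<lambda>\<omega>. F (W \<omega>))"
    proof (rule Bochner_Integration.integrable_bound)
      show "integrable M (\<lambda>\<omega>. cmod (g (W \<omega>)) powr p + cmod (h (W \<omega>)) powr p)" using iS iV by simp
      show "AE \<omega> in M. norm (F (W \<omega>)) \<le> norm (cmod (g (W \<omega>)) powr p + cmod (h (W \<omega>)) powr p)"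
        using powr_sub_one_mult_le[OF p] by (auto simp: F_def norm_mult mult.assoc)
    qed measurable
    have 1: "integrable M (\<lambda>\<omega>. f (U \<omega>) * F (W \<omega>))"
      by (rule indep_var_integrable[OF i X(1) iF])
    have "(\<integral>\<omega>. cmod (g (W \<omega>)) powr (p - 2) * (g (W \<omega>) \<bullet> (f (U \<omega>) * h (W \<omega>))) \<partial>M)
        = (\<integral>\<omega>. Re (f (U \<omega>) * F (W \<omega>)) \<partial>M)"
      by (intro Bochner_Integration.integral_cong) (auto simp: F_def inner_complex_def algebra_simps)
    also have "\<dots> = Re (\<integral>\<omega>. f (U \<omega>) * F (W \<omega>) \<partial>M)" using 1 by (rule integral_Re)
    also have "\<dots> = 0"
      unfolding indep_var_lebesgue_integral[OF i X(1) iF] using X(2) by simp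
    finally show ?thesis .
  qed
  show ?thesis
    by (rule Lp_norm_add_orthogonal_le[OF p _ _ S prod _ orth]) (use X V in auto)
qed

section \<open>Forms in independent variables\<close>

text \<open>
  With \<open>K = 2 * smooth_const p\<close>, linear forms need a constant \<open>A \<ge> \<surd>K\<close> and quadratic forms need
  \<open>A\<^sup>2 \<ge> \<surd>2 K\<close>; this is \<open>A = \<surd>(2 K)\<close>.
\<close>

definition moment_const :: "real \<Rightarrow> real" where
  "moment_const p = 2 * sqrt (smooth_const p)"

lemma (in prob_space) Lp_norm_linear_form_le:
  fixes X :: "'i \<Rightarrow> 'a \<Rightarrow> complex"
  assumes p: "2 \<le> p" and "finite I" and "indep_vars (\<lambda>_. borel) X I"
    and "\<And>i. i \<in> I \<Longrightarrow> integrable M (X i)" and "\<And>i. i \<in> I \<Longrightarrow> expectation (X i) = 0"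
    and "\<And>i. i \<in> I \<Longrightarrow> Lp_norm M p (X i) \<le> ennreal \<mu>" and \<mu>: "0 \<le> \<mu>"
  shows "Lp_norm M p (\<lambda>\<omega>. \<Sum>i\<in>I. b i * X i \<omega>)
    \<le> ennreal (sqrt (2 * smooth_const p) * \<mu> * sqrt (\<Sum>i\<in>I. (cmod (b i))\<^sup>2))"
  using assms(2-6)
proof (induction I rule: finite_induct)
  case empty
  show ?case using Lp_norm_const_le[of p 0] p by simp
next
  case (insert k F)
  define K where "K = 2 * smooth_const p"
  have K: "0 \<le> K" using smooth_const_ge_one[OF p] by (simp add: K_def)
  define s where "s = sqrt K * \<mu> * sqrt (\<Sum>i\<in>F. (cmod (b i))\<^sup>2)"
  have s0: "0 \<le> s" using K \<mu> by (auto simp: s_def intro!: mult_nonneg_nonneg sum_nonneg)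
  define g where "g = (\<lambda>y. \<Sum>i\<in>F. b i * (y i :: complex))"
  have ind: "indep_var (PiM {k} (\<lambda>_. borel)) (\<lambda>\<omega>. restrict (\<lambda>i. X i \<omega>) {k})
      (PiM F (\<lambda>_. borel)) (\<lambda>\<omega>. restrict (\<lambda>i. X i \<omega>) F)"
    using insert.hyps by (intro indep_var_restrict[OF insert.prems(1)]) auto
  have eq: "g (restrict (\<lambda>i. X i \<omega>) F) = (\<Sum>i\<in>F. b i * X i \<omega>)" for \<omega>
    unfolding g_def by (intro sum.cong) auto
  have IH: "Lp_norm M p (\<lambda>\<omega>. \<Sum>i\<in>F. b i * X i \<omega>) \<le> ennreal s"
    unfolding s_def K_def using insert.prems
    by (intro insert.IH indep_vars_subset[OF insert.prems(1)]) auto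
  \<comment> \<open>Adding \<open>k\<close> adds the term \<open>X k * V\<close> with the constant factor \<open>V = b k\<close>.\<close>
  have "Lp_norm M p (\<lambda>\<omega>. g (restrict (\<lambda>i. X i \<omega>) F) + restrict (\<lambda>i. X i \<omega>) {k} k * b k)
      \<le> ennreal (sqrt (s\<^sup>2 + 2 * smooth_const p * (\<mu> * cmod (b k))\<^sup>2))"
  proof (rule Lp_norm_add_indep_mult_le[OF p ind])
    show "g \<in> borel_measurable (PiM F (\<lambda>_. borel))" unfolding g_def by measurable
    show "Lp_norm M p (\<lambda>\<omega>. g (restrict (\<lambda>i. X i \<omega>) F)) \<le> ennreal s"
      unfolding eq by (rule IH)
    show "Lp_norm M p (\<lambda>\<omega>. b k) \<le> ennreal (cmod (b k))" using p by (intro Lp_norm_const_le) auto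
  qed (use insert.prems \<mu> s0 in auto)
  also have "s\<^sup>2 + 2 * smooth_const p * (\<mu> * cmod (b k))\<^sup>2 = K * \<mu>\<^sup>2 * (\<Sum>i\<in>insert k F. (cmod (b i))\<^sup>2)"
    using insert.hyps K by (simp add: s_def K_def power_mult_distrib sum_nonneg algebra_simps)
  also have "sqrt \<dots> = sqrt K * \<mu> * sqrt (\<Sum>i\<in>insert k F. (cmod (b i))\<^sup>2)"
    using \<mu> by (simp add: real_sqrt_mult)
  finally show ?case
    unfolding eq using insert.hyps by (simp add: K_def algebra_simps)
qed

lemma norm_add_square_le:
  fixes x y :: "'a::real_normed_vector"
  shows "(norm (x + y))\<^sup>2 \<le> 2 * ((norm x)\<^sup>2 + (norm y)\<^sup>2)"
proof -
  have "(norm (x + y))\<^sup>2 \<le> (norm x + norm y)\<^sup>2" by (intro power_mono norm_triangle_ineq) auto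
  also have "\<dots> \<le> 2 * ((norm x)\<^sup>2 + (norm y)\<^sup>2)"
    using zero_le_power2[of "norm x - norm y"] by (simp add: power2_eq_square algebra_simps)
  finally show ?thesis .
qed

lemma sum_square_insert:
  fixes f :: "'i \<Rightarrow> 'i \<Rightarrow> 'b::comm_monoid_add"
  assumes "finite F" "k \<notin> F"
  shows "(\<Sum>i\<in>insert k F. \<Sum>j\<in>insert k F. f i j)
    = f k k + (\<Sum>i\<in>F. f i k + f k i) + (\<Sum>i\<in>F. \<Sum>j\<in>F. f i j)"
  using assms by (simp add: sum.distrib add_ac)

text \<open>
  Write \<open>|a|\<close> for the Frobenius norm. If \<open>I\<close> grows by \<open>k\<close>, the square of the bound grows by
  \<open>K \<mu>\<^sup>2 v\<^sup>2\<close>, where \<open>v\<close> with \<open>v\<^sup>2 = K \<mu>\<^sup>2 \<Sum>\<^sub>i |a\<^sub>i\<^sub>k + a\<^sub>k\<^sub>i|\<^sup>2\<close> bounds the norm of the new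
  linear form. This is at most
  \<open>2 K\<^sup>2 \<mu>\<^sup>4\<close> times the growth of \<open>|a|\<^sup>2\<close>; the \<open>2\<close> is the source of \<open>\<surd>2\<close>.
\<close>

lemma (in prob_space) Lp_norm_quadratic_form_le:
  fixes X :: "'i \<Rightarrow> 'a \<Rightarrow> complex"
  assumes p: "2 \<le> p" and "finite I" and "indep_vars (\<lambda>_. borel) X I"
    and "\<And>i. i \<in> I \<Longrightarrow> integrable M (X i)" and "\<And>i. i \<in> I \<Longrightarrow> expectation (X i) = 0"
    and "\<And>i. i \<in> I \<Longrightarrow> Lp_norm M p (X i) \<le> ennreal \<mu>"
    and "\<And>i. i \<in> I \<Longrightarrow> a i i = 0" and \<mu>: "0 \<le> \<mu>"
  shows "Lp_norm M p (\<lambda>\<omega>. \<Sum>i\<in>I. \<Sum>j\<in>I. a i j * X i \<omega> * X j \<omega>)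
    \<le> ennreal (sqrt 2 * (2 * smooth_const p) * \<mu>\<^sup>2 * sqrt (\<Sum>i\<in>I. \<Sum>j\<in>I. (cmod (a i j))\<^sup>2))"
  using assms(2-7)
proof (induction I rule: finite_induct)
  case empty
  show ?case using Lp_norm_const_le[of p 0] p by simp
next
  case (insert k F)
  define K where "K = 2 * smooth_const p"
  have K: "0 \<le> K" using smooth_const_ge_one[OF p] by (simp add: K_def)
  define s where "s = sqrt 2 * K * \<mu>\<^sup>2 * sqrt (\<Sum>i\<in>F. \<Sum>j\<in>F. (cmod (a i j))\<^sup>2)"
  have s0: "0 \<le> s" using K \<mu> by (auto simp: s_def intro!: mult_nonneg_nonneg sum_nonneg)
  define c where "c i = a i k + a k i" for i
  define v where "v = sqrt K * \<mu> * sqrt (\<Sum>i\<in>F. (cmod (c i))\<^sup>2)"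
  have v0: "0 \<le> v" using K \<mu> by (auto simp: v_def intro!: mult_nonneg_nonneg sum_nonneg)
  define g where "g = (\<lambda>y. \<Sum>i\<in>F. \<Sum>j\<in>F. a i j * y i * (y j :: complex))"
  define h where "h = (\<lambda>y. \<Sum>i\<in>F. c i * (y i :: complex))"
  have ind: "indep_var (PiM {k} (\<lambda>_. borel)) (\<lambda>\<omega>. restrict (\<lambda>i. X i \<omega>) {k})
      (PiM F (\<lambda>_. borel)) (\<lambda>\<omega>. restrict (\<lambda>i. X i \<omega>) F)"
    using insert.hyps by (intro indep_var_restrict[OF insert.prems(1)]) auto
  have indF: "indep_vars (\<lambda>_. borel) X F"
    by (intro indep_vars_subset[OF insert.prems(1)]) auto
  have eqg: "g (restrict (\<lambda>i. X i \<omega>) F) = (\<Sum>i\<in>F. \<Sum>j\<in>F. a i j * X i \<omega> * X j \<omega>)" for \<omega>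
    unfolding g_def by (intro sum.cong) auto
  have eqh: "h (restrict (\<lambda>i. X i \<omega>) F) = (\<Sum>i\<in>F. c i * X i \<omega>)" for \<omega>
    unfolding h_def by (intro sum.cong) auto
  have bound: "Lp_norm M p (\<lambda>\<omega>. g (restrict (\<lambda>i. X i \<omega>) F)
        + restrict (\<lambda>i. X i \<omega>) {k} k * h (restrict (\<lambda>i. X i \<omega>) F))
      \<le> ennreal (sqrt (s\<^sup>2 + 2 * smooth_const p * (\<mu> * v)\<^sup>2))"
  proof (rule Lp_norm_add_indep_mult_le[OF p ind])
    show "g \<in> borel_measurable (PiM F (\<lambda>_. borel))" unfolding g_def by measurable
    show "h \<in> borel_measurable (PiM F (\<lambda>_. borel))" unfolding h_def by measurable
    show "Lp_norm M p (\<lambda>\<omega>. g (restrict (\<lambda>i. X i \<omega>) F)) \<le> ennreal s"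
      unfolding eqg s_def K_def using insert.prems by (intro insert.IH indF) auto
    show "Lp_norm M p (\<lambda>\<omega>. h (restrict (\<lambda>i. X i \<omega>) F)) \<le> ennreal v"
      unfolding eqh v_def K_def using insert.prems insert.hyps \<mu>
      by (intro Lp_norm_linear_form_le p indF) auto
  qed (use insert.prems \<mu> s0 v0 in auto)
  have eq: "(\<Sum>i\<in>insert k F. \<Sum>j\<in>insert k F. a i j * X i \<omega> * X j \<omega>)
      = g (restrict (\<lambda>i. X i \<omega>) F) + restrict (\<lambda>i. X i \<omega>) {k} k * h (restrict (\<lambda>i. X i \<omega>) F)" for \<omega>
    unfolding sum_square_insert[OF insert.hyps] eqg eqh
    using insert.prems(5)[of k] by (simp add: c_def sum_distrib_left algebra_simps)
  have "(\<Sum>i\<in>F. (cmod (c i))\<^sup>2) \<le> (\<Sum>i\<in>F. 2 * ((cmod (a i k))\<^sup>2 + (cmod (a k i))\<^sup>2))"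
    unfolding c_def by (intro sum_mono norm_add_square_le)
  then have "K\<^sup>2 * \<mu>^4 * (\<Sum>i\<in>F. (cmod (c i))\<^sup>2)
      \<le> K\<^sup>2 * \<mu>^4 * (2 * (\<Sum>i\<in>F. (cmod (a i k))\<^sup>2 + (cmod (a k i))\<^sup>2))"
    using K \<mu> by (intro mult_left_mono) (auto simp: sum_distrib_left)
  moreover have "K * (\<mu> * v)\<^sup>2 = K\<^sup>2 * \<mu>^4 * (\<Sum>i\<in>F. (cmod (c i))\<^sup>2)"
  proof -
    have "v\<^sup>2 = K * \<mu>\<^sup>2 * (\<Sum>i\<in>F. (cmod (c i))\<^sup>2)"
      using K by (simp add: v_def power_mult_distrib sum_nonneg)
    then show ?thesis by algebra
  qed
  moreover have "s\<^sup>2 = 2 * K\<^sup>2 * \<mu>^4 * (\<Sum>i\<in>F. \<Sum>j\<in>F. (cmod (a i j))\<^sup>2)"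
    by (simp add: s_def power_mult_distrib sum_nonneg flip: power_mult)
  moreover have "(\<Sum>i\<in>insert k F. \<Sum>j\<in>insert k F. (cmod (a i j))\<^sup>2)
      = (\<Sum>i\<in>F. (cmod (a i k))\<^sup>2 + (cmod (a k i))\<^sup>2) + (\<Sum>i\<in>F. \<Sum>j\<in>F. (cmod (a i j))\<^sup>2)"
    unfolding sum_square_insert[OF insert.hyps] using insert.prems(5)[of k] by simp
  ultimately have "s\<^sup>2 + K * (\<mu> * v)\<^sup>2 \<le> 2 * K\<^sup>2 * \<mu>^4 * (\<Sum>i\<in>insert k F. \<Sum>j\<in>insert k F. (cmod (a i j))\<^sup>2)"
    by (simp only:) (simp add: algebra_simps)
  then have "sqrt (s\<^sup>2 + K * (\<mu> * v)\<^sup>2)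
      \<le> sqrt (2 * K\<^sup>2 * \<mu>^4 * (\<Sum>i\<in>insert k F. \<Sum>j\<in>insert k F. (cmod (a i j))\<^sup>2))"
    by (rule real_sqrt_le_mono)
  also have "\<dots> = sqrt 2 * K * \<mu>\<^sup>2 * sqrt (\<Sum>i\<in>insert k F. \<Sum>j\<in>insert k F. (cmod (a i j))\<^sup>2)"
  proof -
    have "sqrt (\<mu>^4) = \<mu>\<^sup>2" by (intro real_sqrt_unique) (auto simp flip: power_mult)
    then show ?thesis using K by (simp add: real_sqrt_mult)
  qed
  finally show ?case
    unfolding eq using bound by (auto simp: K_def intro: order_trans[OF _ ennreal_leI])
qed

text \<open>
  Cauchy-Schwarz on the support. Counting only the nonzero terms matters below: the joint
  family has \<open>2 N\<close> members, but each coefficient row or column is supported on at most \<open>N\<close> of them.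
\<close>

lemma norm_sum_square_le_card_support:
  fixes f :: "'i \<Rightarrow> 'b::real_normed_vector"
  assumes "finite I" "card {i\<in>I. f i \<noteq> 0} \<le> n"
  shows "(norm (\<Sum>i\<in>I. f i))\<^sup>2 \<le> real n * (\<Sum>i\<in>I. (norm (f i))\<^sup>2)"
proof -
  define J where "J = {i\<in>I. f i \<noteq> 0}"
  have J: "finite J" "J \<subseteq> I" "card J \<le> n" using assms by (auto simp: J_def)
  have "(\<Sum>i\<in>I. f i) = (\<Sum>i\<in>J. f i)"
    using assms J by (intro sum.mono_neutral_right) (auto simp: J_def)
  then have "(norm (\<Sum>i\<in>I. f i))\<^sup>2 \<le> (\<Sum>i\<in>J. norm (f i))\<^sup>2"
    by (simp add: power_mono norm_sum)
  also have "\<dots> \<le> (\<Sum>i\<in>J. (norm (f i))\<^sup>2) * card J"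
    by (rule sum_squared_le_sum_of_squares)
  also have "\<dots> \<le> (\<Sum>i\<in>I. (norm (f i))\<^sup>2) * n"
    using J assms by (intro mult_mono sum_mono2 sum_nonneg) auto
  finally show ?thesis by (simp add: mult.commute)
qed

lemma (in prob_space) Lp_norm_shifted_linear_form_le:
  fixes W :: "'i \<Rightarrow> 'a \<Rightarrow> complex"
  assumes p: "2 \<le> p" and I: "finite I" and ind: "indep_vars (\<lambda>_. borel) W I"
    and mean: "\<And>i. i \<in> I \<Longrightarrow> has_bochner_integral M (W i) m"
    and dev: "\<And>i. i \<in> I \<Longrightarrow> Lp_norm M p (\<lambda>\<omega>. W i \<omega> - m) \<le> ennreal \<mu>" and \<mu>: "0 \<le> \<mu>"
    and supp: "card {i\<in>I. b i \<noteq> 0} \<le> n"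
  shows "Lp_norm M p (\<lambda>\<omega>. \<Sum>i\<in>I. b i * W i \<omega>)
    \<le> ennreal ((moment_const p * \<mu> + sqrt n * cmod m) * sqrt (\<Sum>i\<in>I. (cmod (b i))\<^sup>2))"
proof -
  define X where "X = (\<lambda>i \<omega>. W i \<omega> - m)"
  define e where "e = sqrt (\<Sum>i\<in>I. (cmod (b i))\<^sup>2)"
  have e0: "0 \<le> e" by (simp add: e_def sum_nonneg)
  have C: "1 \<le> smooth_const p" by (rule smooth_const_ge_one[OF p])
  have indX: "indep_vars (\<lambda>_. borel) X I"
    unfolding X_def by (rule indep_vars_compose2[OF ind, of "\<lambda>_ x. x - m"]) auto
  have rv: "X i \<in> borel_measurable M" if "i \<in> I" for i
    using indX that by (auto simp: indep_vars_def)
  have intX: "integrable M (X i)" "expectation (X i) = 0" if "i \<in> I" for i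
    using mean[OF that] by (auto simp: X_def has_bochner_integral_iff prob_space)
  have "Lp_norm M p (\<lambda>\<omega>. \<Sum>i\<in>I. b i * X i \<omega>) \<le> ennreal (sqrt (2 * smooth_const p) * \<mu> * e)"
    unfolding e_def using dev by (intro Lp_norm_linear_form_le p I indX intX \<mu>) (auto simp: X_def)
  also have "\<dots> \<le> ennreal (moment_const p * \<mu> * e)"
  proof -
    have "sqrt (2 * smooth_const p) \<le> sqrt (4 * smooth_const p)" using C by simp
    also have "\<dots> = moment_const p" by (simp add: moment_const_def real_sqrt_mult)
    finally show ?thesis using \<mu> e0 by (intro ennreal_leI mult_right_mono) auto
  qed
  finally have 1: "Lp_norm M p (\<lambda>\<omega>. \<Sum>i\<in>I. b i * X i \<omega>) \<le> ennreal (moment_const p * \<mu> * e)" .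
  have "cmod (\<Sum>i\<in>I. b i) \<le> sqrt n * e"
    unfolding e_def real_sqrt_mult[symmetric]
    by (intro real_le_rsqrt norm_sum_square_le_card_support I supp)
  then have "cmod m * cmod (\<Sum>i\<in>I. b i) \<le> cmod m * (sqrt n * e)"
    by (intro mult_left_mono) auto
  then have "cmod (m * (\<Sum>i\<in>I. b i)) \<le> sqrt n * cmod m * e"
    by (simp add: norm_mult mult_ac)
  then have 2: "Lp_norm M p (\<lambda>\<omega>. m * (\<Sum>i\<in>I. b i)) \<le> ennreal (sqrt n * cmod m * e)"
    using p by (intro order_trans[OF Lp_norm_const_le ennreal_leI]) auto
  have "Lp_norm M p (\<lambda>\<omega>. (\<Sum>i\<in>I. b i * X i \<omega>) + m * (\<Sum>i\<in>I. b i))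
      \<le> ennreal (moment_const p * \<mu> * e + sqrt n * cmod m * e)"
    using p 1 2 \<mu> e0 C rv by (intro Lp_norm_add_le) (auto simp: moment_const_def)
  moreover have "(\<Sum>i\<in>I. b i * W i \<omega>) = (\<Sum>i\<in>I. b i * X i \<omega>) + m * (\<Sum>i\<in>I. b i)" for \<omega>
    by (simp add: X_def sum_distrib_left sum.distrib[symmetric] algebra_simps)
  ultimately show ?thesis by (simp add: e_def algebra_simps)
qed

text \<open>
  Expanding \<open>W\<^sub>i = X\<^sub>i + m\<close> leaves a centred quadratic form, two linear forms with the row sums and
  the column sums of \<open>m * a\<close> as coefficients, and a constant. The hypotheses on supports
  make these contribute \<open>\<surd>n\<close>, \<open>\<surd>n\<close> and \<open>n\<close>.
\<close>

lemma (in prob_space) Lp_norm_shifted_quadratic_form_le: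
  fixes W :: "'i \<Rightarrow> 'a \<Rightarrow> complex" and a :: "'i \<Rightarrow> 'i \<Rightarrow> complex"
  assumes p: "2 \<le> p" and I: "finite I" and ind: "indep_vars (\<lambda>_. borel) W I"
    and mean: "\<And>i. i \<in> I \<Longrightarrow> has_bochner_integral M (W i) m"
    and dev: "\<And>i. i \<in> I \<Longrightarrow> Lp_norm M p (\<lambda>\<omega>. W i \<omega> - m) \<le> ennreal \<mu>" and \<mu>: "0 \<le> \<mu>"
    and diag: "\<And>i. i \<in> I \<Longrightarrow> a i i = 0"
    and rows: "\<And>i. i \<in> I \<Longrightarrow> card {j\<in>I. a i j \<noteq> 0} \<le> n"
    and cols: "\<And>j. j \<in> I \<Longrightarrow> card {i\<in>I. a i j \<noteq> 0} \<le> n"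
    and supp: "card {(i, j)\<in>I \<times> I. a i j \<noteq> 0} \<le> n\<^sup>2"
  shows "Lp_norm M p (\<lambda>\<omega>. \<Sum>i\<in>I. \<Sum>j\<in>I. a i j * W i \<omega> * W j \<omega>)
    \<le> ennreal (((moment_const p)\<^sup>2 * \<mu>\<^sup>2 + 2 * moment_const p * \<mu> * sqrt n * cmod m + n * (cmod m)\<^sup>2)
        * sqrt (\<Sum>i\<in>I. \<Sum>j\<in>I. (cmod (a i j))\<^sup>2))"
proof -
  define A where "A = moment_const p"
  define X where "X = (\<lambda>i \<omega>. W i \<omega> - m)"
  define e where "e = sqrt (\<Sum>i\<in>I. \<Sum>j\<in>I. (cmod (a i j))\<^sup>2)"
  have e0: "0 \<le> e" by (simp add: e_def sum_nonneg)
  have C: "1 \<le> smooth_const p" by (rule smooth_const_ge_one[OF p])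
  have A0: "0 \<le> A" using C by (simp add: A_def moment_const_def)
  have A2: "A\<^sup>2 = 4 * smooth_const p" using C by (simp add: A_def moment_const_def power_mult_distrib)
  have indX: "indep_vars (\<lambda>_. borel) X I"
    unfolding X_def by (rule indep_vars_compose2[OF ind, of "\<lambda>_ x. x - m"]) auto
  have rv: "X i \<in> borel_measurable M" if "i \<in> I" for i
    using indX that by (auto simp: indep_vars_def)
  have intX: "integrable M (X i)" "expectation (X i) = 0" if "i \<in> I" for i
    using mean[OF that] by (auto simp: X_def has_bochner_integral_iff prob_space)
  have devX: "Lp_norm M p (X i) \<le> ennreal \<mu>" if "i \<in> I" for i
    using dev[OF that] by (simp add: X_def)
  have "Lp_norm M p (\<lambda>\<omega>. \<Sum>i\<in>I. \<Sum>j\<in>I. a i j * X i \<omega> * X j \<omega>)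
      \<le> ennreal (sqrt 2 * (2 * smooth_const p) * \<mu>\<^sup>2 * e)"
    unfolding e_def by (intro Lp_norm_quadratic_form_le p I indX intX devX diag \<mu>)
  also have "\<dots> \<le> ennreal (A\<^sup>2 * \<mu>\<^sup>2 * e)"
  proof -
    have "sqrt 2 * (2 * smooth_const p) \<le> 2 * (2 * smooth_const p)"
      using C by (intro mult_right_mono) (auto intro: real_le_lsqrt)
    then show ?thesis using e0 A2 by (intro ennreal_leI mult_right_mono) auto
  qed
  finally have 1: "Lp_norm M p (\<lambda>\<omega>. \<Sum>i\<in>I. \<Sum>j\<in>I. a i j * X i \<omega> * X j \<omega>) \<le> ennreal (A\<^sup>2 * \<mu>\<^sup>2 * e)" .
  have line: "Lp_norm M p (\<lambda>\<omega>. m * (\<Sum>i\<in>I. (\<Sum>j\<in>I. c i j) * X i \<omega>)) \<le> ennreal (A * \<mu> * sqrt n * cmod m * e)"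
    if rows: "\<And>i. i \<in> I \<Longrightarrow> card {j\<in>I. c i j \<noteq> 0} \<le> n"
      and c: "(\<Sum>i\<in>I. \<Sum>j\<in>I. (cmod (c i j))\<^sup>2) = (\<Sum>i\<in>I. \<Sum>j\<in>I. (cmod (a i j))\<^sup>2)"
    for c :: "'i \<Rightarrow> 'i \<Rightarrow> complex"
  proof -
    have "(\<Sum>i\<in>I. (cmod (\<Sum>j\<in>I. c i j))\<^sup>2) \<le> (\<Sum>i\<in>I. n * (\<Sum>j\<in>I. (cmod (c i j))\<^sup>2))"
      by (intro sum_mono norm_sum_square_le_card_support I rows)
    then have r: "sqrt (\<Sum>i\<in>I. (cmod (\<Sum>j\<in>I. c i j))\<^sup>2) \<le> sqrt n * e"
      unfolding e_def real_sqrt_mult[symmetric] by (simp add: c flip: sum_distrib_left)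
    have "sqrt (2 * smooth_const p) \<le> A"
      using C A2 A0 by (intro real_le_lsqrt) auto
    then have "sqrt (2 * smooth_const p) * \<mu> * sqrt (\<Sum>i\<in>I. (cmod (\<Sum>j\<in>I. c i j))\<^sup>2) \<le> A * \<mu> * (sqrt n * e)"
      using r A0 \<mu> by (intro mult_mono) (auto intro!: sum_nonneg)
    moreover have "Lp_norm M p (\<lambda>\<omega>. \<Sum>i\<in>I. (\<Sum>j\<in>I. c i j) * X i \<omega>)
        \<le> ennreal (sqrt (2 * smooth_const p) * \<mu> * sqrt (\<Sum>i\<in>I. (cmod (\<Sum>j\<in>I. c i j))\<^sup>2))"
      by (intro Lp_norm_linear_form_le p I indX intX devX \<mu>)
    ultimately have "Lp_norm M p (\<lambda>\<omega>. \<Sum>i\<in>I. (\<Sum>j\<in>I. c i j) * X i \<omega>) \<le> ennreal (A * \<mu> * (sqrt n * e))"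
      by (blast intro: order_trans ennreal_leI)
    then have "Lp_norm M p (\<lambda>\<omega>. m * (\<Sum>i\<in>I. (\<Sum>j\<in>I. c i j) * X i \<omega>)) \<le> ennreal (cmod m * (A * \<mu> * (sqrt n * e)))"
      using p A0 \<mu> e0 rv by (intro Lp_norm_cmult_le) auto
    then show ?thesis by (simp add: mult_ac)
  qed
  have 2: "Lp_norm M p (\<lambda>\<omega>. m * (\<Sum>i\<in>I. (\<Sum>j\<in>I. a i j) * X i \<omega>)) \<le> ennreal (A * \<mu> * sqrt n * cmod m * e)"
    using rows by (intro line) auto
  have 3: "Lp_norm M p (\<lambda>\<omega>. m * (\<Sum>j\<in>I. (\<Sum>i\<in>I. a i j) * X j \<omega>)) \<le> ennreal (A * \<mu> * sqrt n * cmod m * e)"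
    using cols by (intro line[of "\<lambda>j i. a i j"] sum.swap) auto
  have "(cmod (\<Sum>x\<in>I \<times> I. case x of (i, j) \<Rightarrow> a i j))\<^sup>2
      \<le> real (n\<^sup>2) * (\<Sum>x\<in>I \<times> I. (cmod (case x of (i, j) \<Rightarrow> a i j))\<^sup>2)"
  proof (rule norm_sum_square_le_card_support)
    have "{x \<in> I \<times> I. (case x of (i, j) \<Rightarrow> a i j) \<noteq> 0} = {(i, j)\<in>I \<times> I. a i j \<noteq> 0}" by auto
    then show "card {x \<in> I \<times> I. (case x of (i, j) \<Rightarrow> a i j) \<noteq> 0} \<le> n\<^sup>2" using supp by simp
  qed (use I in auto)
  then have "cmod (\<Sum>i\<in>I. \<Sum>j\<in>I. a i j) \<le> sqrt (real (n\<^sup>2) * (\<Sum>i\<in>I. \<Sum>j\<in>I. (cmod (a i j))\<^sup>2))"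
    by (intro real_le_rsqrt) (simp add: sum.cartesian_product split_def)
  also have "\<dots> = n * e" by (simp add: e_def real_sqrt_mult)
  finally have "cmod (m\<^sup>2 * (\<Sum>i\<in>I. \<Sum>j\<in>I. a i j)) \<le> (cmod m)\<^sup>2 * (n * e)"
    by (simp add: norm_mult norm_power mult_left_mono)
  then have 4: "Lp_norm M p (\<lambda>\<omega>. m\<^sup>2 * (\<Sum>i\<in>I. \<Sum>j\<in>I. a i j)) \<le> ennreal (n * (cmod m)\<^sup>2 * e)"
    using p by (intro order_trans[OF Lp_norm_const_le ennreal_leI]) (auto simp: mult_ac)
  have "Lp_norm M p (\<lambda>\<omega>. (\<Sum>i\<in>I. \<Sum>j\<in>I. a i j * X i \<omega> * X j \<omega>)
        + (m * (\<Sum>i\<in>I. (\<Sum>j\<in>I. a i j) * X i \<omega>)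
        + (m * (\<Sum>j\<in>I. (\<Sum>i\<in>I. a i j) * X j \<omega>)
        + m\<^sup>2 * (\<Sum>i\<in>I. \<Sum>j\<in>I. a i j))))
      \<le> ennreal (A\<^sup>2 * \<mu>\<^sup>2 * e + (A * \<mu> * sqrt n * cmod m * e + (A * \<mu> * sqrt n * cmod m * e + n * (cmod m)\<^sup>2 * e)))"
    using p A0 \<mu> e0 rv
    by (intro Lp_norm_add_le 1 2 3 4 borel_measurable_add borel_measurable_sum borel_measurable_times
        borel_measurable_const) auto
  moreover have "(\<Sum>i\<in>I. \<Sum>j\<in>I. a i j * W i \<omega> * W j \<omega>)
      = (\<Sum>i\<in>I. \<Sum>j\<in>I. a i j * X i \<omega> * X j \<omega>)
        + (m * (\<Sum>i\<in>I. (\<Sum>j\<in>I. a i j) * X i \<omega>)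
        + (m * (\<Sum>j\<in>I. (\<Sum>i\<in>I. a i j) * X j \<omega>)
        + m\<^sup>2 * (\<Sum>i\<in>I. \<Sum>j\<in>I. a i j)))" for \<omega>
  proof -
    have expand: "a i j * W i \<omega> * W j \<omega> = a i j * X i \<omega> * X j \<omega>
        + (m * (a i j * X i \<omega>) + (m * (a i j * X j \<omega>) + m\<^sup>2 * a i j))" for i j
      by (simp add: X_def power2_eq_square algebra_simps)
    have swap: "m * (\<Sum>j\<in>I. (\<Sum>i\<in>I. a i j) * X j \<omega>) = (\<Sum>i\<in>I. \<Sum>j\<in>I. m * (a i j * X j \<omega>))"
      unfolding sum_distrib_right sum_distrib_left by (rule sum.swap)
    show ?thesis
      unfolding expand sum.distrib swap by (simp only: sum_distrib_left sum_distrib_right)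
  qed
  ultimately show ?thesis by (simp add: e_def A_def algebra_simps)
qed

section \<open>Constants valid on every sample space\<close>

text \<open>
  The coefficients are extended by zero to the joint index set: the vector \<open>b\<close> and the off-diagonal
  part of \<open>a\<close> on the \<open>Y\<close>-indices for (i) and (iii), the matrix \<open>a\<close> as the block that pairs
  \<open>Y\<close>-indices with \<open>Z\<close>-indices for (ii). Both matrices have zero diagonal.
\<close>

lemma moment_constants_moment_const: "moment_constants TYPE('a) moment_const"
  unfolding moment_constants_def
proof (intro conjI allI impI)
  show "0 \<le> moment_const p" if "2 \<le> p" for p
    using smooth_const_ge_one[OF that] by (simp add: moment_const_def)
next
  fix M :: "'a measure" and N :: nat and a :: "nat \<Rightarrow> nat \<Rightarrow> complex" and b :: "nat \<Rightarrow> complex"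
    and Y Z :: "nat \<Rightarrow> 'a \<Rightarrow> complex" and m :: complex and \<mu> :: "real \<Rightarrow> real" and p :: real
  assume "prob_space M" and ind: "independent_families M N Y Z"
    and mean: "\<forall>i\<in>{1..N}. has_bochner_integral M (Y i) m \<and> has_bochner_integral M (Z i) m"
    and dev: "\<forall>p\<ge>2. 0 \<le> \<mu> p \<and>
           (\<forall>i\<in>{1..N}. Lp_norm M p (\<lambda>\<omega>. Y i \<omega> - m) \<le> ennreal (\<mu> p) \<and>
                       Lp_norm M p (\<lambda>\<omega>. Z i \<omega> - m) \<le> ennreal (\<mu> p))"
    and p: "2 \<le> p"
  interpret prob_space M by fact
  define I :: "(nat + nat) set" where "I = {1..N} <+> {1..N}"
  define W where "W = case_sum Y Z"
  have I: "finite I" by (simp add: I_def)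
  have indW: "indep_vars (\<lambda>_. borel) W I" using ind by (simp add: independent_families_def W_def I_def)
  have meanW: "has_bochner_integral M (W i) m" if "i \<in> I" for i
    using that mean by (auto simp: W_def I_def)
  have \<mu>: "0 \<le> \<mu> p" using dev p by auto
  have const: "0 \<le> moment_const p" using smooth_const_ge_one[OF p] by (simp add: moment_const_def)
  have devW: "Lp_norm M p (\<lambda>\<omega>. W i \<omega> - m) \<le> ennreal (\<mu> p)" if "i \<in> I" for i
    using that dev p by (auto simp: W_def I_def)
  have sumI: "sum f I = (\<Sum>i\<in>{1..N}. f (Inl i)) + (\<Sum>i\<in>{1..N}. f (Inr i))"
    for f :: "nat + nat \<Rightarrow> 'c::comm_monoid_add"
    unfolding I_def by (subst sum.Plus) (auto simp: comp_def)
  have card_Inl: "card S \<le> N" if "S \<subseteq> Inl ` {1..N}" for S :: "(nat + nat) set"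
    using card_mono[OF _ that] card_image_le[of "{1..N}" "Inl :: nat \<Rightarrow> nat + nat"] by simp
  have card_Inr: "card S \<le> N" if "S \<subseteq> Inr ` {1..N}" for S :: "(nat + nat) set"
    using card_mono[OF _ that] card_image_le[of "{1..N}" "Inr :: nat \<Rightarrow> nat + nat"] by simp
  have card_Pair: "card S \<le> N\<^sup>2" if "S \<subseteq> (\<lambda>(i, j). (Inl i, \<phi> j)) ` ({1..N} \<times> {1..N})"
    for S :: "((nat + nat) \<times> (nat + nat)) set" and \<phi> :: "nat \<Rightarrow> nat + nat"
    using card_mono[OF _ that] card_image_le[of "{1..N} \<times> {1..N}" "\<lambda>(i, j). (Inl i :: nat + nat, \<phi> j)"]
    by (simp add: power2_eq_square)

  define b' :: "nat + nat \<Rightarrow> complex" where "b' = case_sum b (\<lambda>_. 0)"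
  have "Lp_norm M p (\<lambda>\<omega>. \<Sum>i\<in>I. b' i * W i \<omega>)
      \<le> ennreal ((moment_const p * \<mu> p + sqrt N * cmod m) * sqrt (\<Sum>i\<in>I. (cmod (b' i))\<^sup>2))"
    by (intro Lp_norm_shifted_linear_form_le p I indW meanW devW \<mu> card_Inl)
      (auto simp: b'_def I_def)
  then show "Lp_norm M p (\<lambda>\<omega>. \<Sum>i\<in>{1..N}. b i * Y i \<omega>)
      \<le> ennreal ((moment_const p * \<mu> p + sqrt (real N) * cmod m)
          * sqrt (\<Sum>i\<in>{1..N}. (cmod (b i))\<^sup>2))"
    by (simp add: sumI b'_def W_def)

  define c :: "nat + nat \<Rightarrow> nat + nat \<Rightarrow> complex"
    where "c = case_sum (\<lambda>i. case_sum (\<lambda>_. 0) (a i)) (\<lambda>_ _. 0)"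
  have "Lp_norm M p (\<lambda>\<omega>. \<Sum>i\<in>I. \<Sum>j\<in>I. c i j * W i \<omega> * W j \<omega>)
      \<le> ennreal (((moment_const p)\<^sup>2 * (\<mu> p)\<^sup>2 + 2 * moment_const p * \<mu> p * sqrt N * cmod m + N * (cmod m)\<^sup>2)
        * sqrt (\<Sum>i\<in>I. \<Sum>j\<in>I. (cmod (c i j))\<^sup>2))"
  proof (intro Lp_norm_shifted_quadratic_form_le p I indW meanW devW \<mu>)
    show "c x x = 0" for x by (cases x) (auto simp: c_def)
    show "card {y\<in>I. c x y \<noteq> 0} \<le> N" for x
      by (intro card_Inr, cases x) (auto simp: c_def I_def)
    show "card {x\<in>I. c x y \<noteq> 0} \<le> N" for y
      by (intro card_Inl, cases y) (auto simp: c_def I_def)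
    show "card {(x, y)\<in>I \<times> I. c x y \<noteq> 0} \<le> N\<^sup>2"
      by (intro card_Pair[of _ Inr]) (auto simp: c_def I_def)
  qed
  then show "Lp_norm M p (\<lambda>\<omega>. \<Sum>(i, j)\<in>{1..N} \<times> {1..N}. a i j * Y i \<omega> * Z j \<omega>)
      \<le> ennreal (((moment_const p)\<^sup>2 * (\<mu> p)\<^sup>2 + 2 * moment_const p * \<mu> p * sqrt (real N) * cmod m
            + real N * (cmod m)\<^sup>2)
          * sqrt (\<Sum>(i, j)\<in>{1..N} \<times> {1..N}. (cmod (a i j))\<^sup>2))"
    by (simp add: sumI c_def W_def flip: sum.cartesian_product)

  define d :: "nat + nat \<Rightarrow> nat + nat \<Rightarrow> complex"
    where "d = case_sum (\<lambda>i. case_sum (\<lambda>j. if i \<noteq> j then a i j else 0) (\<lambda>_. 0)) (\<lambda>_ _. 0)"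
  have offdiag: "(\<Sum>(i, j)\<in>{(i, j). i \<in> {1..N} \<and> j \<in> {1..N} \<and> i \<noteq> j}. f i j)
      = (\<Sum>i\<in>{1..N}. \<Sum>j\<in>{1..N}. if i \<noteq> j then f i j else 0)" for f :: "nat \<Rightarrow> nat \<Rightarrow> 'c::comm_monoid_add"
    unfolding sum.cartesian_product
    by (rule sum.mono_neutral_cong_left) auto
  have "Lp_norm M p (\<lambda>\<omega>. \<Sum>i\<in>I. \<Sum>j\<in>I. d i j * W i \<omega> * W j \<omega>)
      \<le> ennreal (((moment_const p)\<^sup>2 * (\<mu> p)\<^sup>2 + 2 * moment_const p * \<mu> p * sqrt N * cmod m + N * (cmod m)\<^sup>2)
        * sqrt (\<Sum>i\<in>I. \<Sum>j\<in>I. (cmod (d i j))\<^sup>2))"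
  proof (intro Lp_norm_shifted_quadratic_form_le p I indW meanW devW \<mu>)
    show "d x x = 0" for x by (cases x) (auto simp: d_def)
    show "card {y\<in>I. d x y \<noteq> 0} \<le> N" for x
      by (intro card_Inl, cases x) (auto simp: d_def I_def)
    show "card {x\<in>I. d x y \<noteq> 0} \<le> N" for y
      by (intro card_Inl, cases y) (auto simp: d_def I_def)
    show "card {(x, y)\<in>I \<times> I. d x y \<noteq> 0} \<le> N\<^sup>2"
      by (intro card_Pair[of _ Inl]) (auto simp: d_def I_def)
  qed
  also have "(\<lambda>\<omega>. \<Sum>i\<in>I. \<Sum>j\<in>I. d i j * W i \<omega> * W j \<omega>)
      = (\<lambda>\<omega>. \<Sum>(i, j)\<in>{(i, j). i \<in> {1..N} \<and> j \<in> {1..N} \<and> i \<noteq> j}. a i j * Y i \<omega> * Y j \<omega>)"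
    unfolding offdiag by (auto simp: sumI d_def W_def fun_eq_iff intro!: sum.cong)
  also have "(\<Sum>i\<in>I. \<Sum>j\<in>I. (cmod (d i j))\<^sup>2)
      = (\<Sum>(i, j)\<in>{(i, j). i \<in> {1..N} \<and> j \<in> {1..N} \<and> i \<noteq> j}. (cmod (a i j))\<^sup>2)"
    unfolding offdiag by (auto simp: sumI d_def intro!: sum.cong)
  also have "ennreal (((moment_const p)\<^sup>2 * (\<mu> p)\<^sup>2 + 2 * moment_const p * \<mu> p * sqrt N * cmod m + N * (cmod m)\<^sup>2)
        * sqrt (\<Sum>(i, j)\<in>{(i, j). i \<in> {1..N} \<and> j \<in> {1..N} \<and> i \<noteq> j}. (cmod (a i j))\<^sup>2))
      \<le> ennreal ((4 * (moment_const p)\<^sup>2 * (\<mu> p)\<^sup>2 + 2 * moment_const p * \<mu> p * sqrt N * cmod m + N * (cmod m)\<^sup>2)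
        * sqrt (\<Sum>(i, j)\<in>{(i, j). i \<in> {1..N} \<and> j \<in> {1..N} \<and> i \<noteq> j}. (cmod (a i j))\<^sup>2))"
    by (intro ennreal_leI mult_right_mono add_mono) (use const \<mu> in \<open>auto intro!: sum_nonneg\<close>)
  finally show "Lp_norm M p (\<lambda>\<omega>. \<Sum>(i, j)\<in>{(i, j). i \<in> {1..N} \<and> j \<in> {1..N} \<and> i \<noteq> j}.
           a i j * Y i \<omega> * Y j \<omega>)
      \<le> ennreal ((4 * (moment_const p)\<^sup>2 * (\<mu> p)\<^sup>2 + 2 * moment_const p * \<mu> p * sqrt (real N) * cmod m
            + real N * (cmod m)\<^sup>2)
          * sqrt (\<Sum>(i, j)\<in>{(i, j). i \<in> {1..N} \<and> j \<in> {1..N} \<and> i \<noteq> j}. (cmod (a i j))\<^sup>2))" .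
qed

section \<open>Transfer between sample spaces\<close>

lemma independent_families_measurable:
  assumes "prob_space M" "independent_families M N Y Z" "i \<in> {1..N}"
  shows "Y i \<in> borel_measurable M" "Z i \<in> borel_measurable M"
  using assms by (force simp: independent_families_def prob_space.indep_vars_def)+

lemma Lp_norm_distr:
  assumes "T \<in> measurable M M'" "X \<in> borel_measurable M'"
  shows "Lp_norm (distr M M' T) p X = Lp_norm M p (\<lambda>\<omega>. X (T \<omega>))"
  using assms by (simp add: Lp_norm_def nn_integral_distr)

text \<open>
  Independence is a property of the joint law, and the joint law of \<open>X\<close> under the image measure
  is that of \<open>X \<circ> T\<close>.
\<close>

lemma (in prob_space) indep_vars_distrI:
  assumes T: "T \<in> measurable M M'" and X: "\<And>i. i \<in> I \<Longrightarrow> X i \<in> measurable M' (N i)"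
    and ind: "indep_vars N (\<lambda>i \<omega>. X i (T \<omega>)) I"
  shows "prob_space.indep_vars (distr M M' T) N X I"
proof (cases "I = {}")
  case True
  interpret D: prob_space "distr M M' T" using T by (rule prob_space_distr)
  show ?thesis unfolding D.indep_vars_def D.indep_sets_def using True by simp
next
  case False
  interpret D: prob_space "distr M M' T" using T by (rule prob_space_distr)
  have XT: "(\<lambda>\<omega>. X i (T \<omega>)) \<in> measurable M (N i)" if "i \<in> I" for i
    using T X[OF that] by measurable
  have restr: "(\<lambda>x. \<lambda>i\<in>I. X i x) \<in> measurable M' (PiM I N)"
    using X by (intro measurable_restrict) auto
  have "distr (distr M M' T) (PiM I N) (\<lambda>x. \<lambda>i\<in>I. X i x) = distr M (PiM I N) (\<lambda>\<omega>. \<lambda>i\<in>I. X i (T \<omega>))"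
    using T restr by (subst distr_distr) (auto simp: comp_def)
  also have "\<dots> = (\<Pi>\<^sub>M i\<in>I. distr M (N i) (\<lambda>\<omega>. X i (T \<omega>)))"
    using ind XT by (subst (asm) indep_vars_iff_distr_eq_PiM'[OF False]) auto
  also have "\<dots> = (\<Pi>\<^sub>M i\<in>I. distr (distr M M' T) (N i) (X i))"
    using T X by (intro PiM_cong) (auto simp: distr_distr comp_def)
  finally show ?thesis
    using X by (subst D.indep_vars_iff_distr_eq_PiM'[OF False]) auto
qed

text \<open>
  The map \<open>T\<close> stores \<open>Y i\<close> at coordinate \<open>2 * i\<close> and \<open>Z i\<close> at coordinate \<open>2 * i + 1\<close>. Under the image
  measure the coordinate functions have the joint law of the original variables, so
  hypotheses and conclusions agree on both spaces.
\<close>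

lemma moment_constants_transfer:
  assumes A: "moment_constants TYPE(nat \<Rightarrow> complex) A"
  shows "moment_constants TYPE('a) A"
  unfolding moment_constants_def
proof (rule conjI, goal_cases)
  case 1
  show ?case using A unfolding moment_constants_def by (rule conjunct1)
next
  case 2
  show ?case
  proof (intro allI impI, goal_cases)
    case (1 M N a b Y Z m \<mu> p)
    interpret prob_space M by (rule 1(1))
    have indM: "independent_families M N Y Z" by (rule 1(2))
    define P where "P = (\<Pi>\<^sub>M n\<in>(UNIV :: nat set). (borel :: complex measure))"
    define T where "T \<omega> = (\<lambda>n. if n div 2 \<in> {1..N} then (if even n then Y (n div 2) \<omega> else Z (n div 2) \<omega>) else 0)" for \<omega>
    define D where "D = distr M P T"
    define Y' Z' where "Y' = (\<lambda>i (x :: nat \<Rightarrow> complex). x (2 * i))" and "Z' = (\<lambda>i (x :: nat \<Rightarrow> complex). x (2 * i + 1))"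
    \<comment> \<open>The value \<open>0\<close> at the other coordinates keeps \<open>T\<close> measurable: \<open>Y i\<close> and \<open>Z i\<close> may be
      arbitrary functions for \<open>i\<close> outside \<open>{1..N}\<close>.\<close>
    have Tn: "(\<lambda>\<omega>. T \<omega> n) \<in> borel_measurable M" for n
      using independent_families_measurable[OF 1(1) indM, of "n div 2"]
      by (cases "n div 2 \<in> {1..N}"; cases "even n") (simp_all add: T_def del: atLeastAtMost_iff)
    have T[measurable]: "T \<in> measurable M P"
      unfolding P_def using Tn by (intro measurable_PiM_single') auto
    have Y'[measurable]: "Y' i \<in> borel_measurable P" and Z'[measurable]: "Z' i \<in> borel_measurable P" for i
      unfolding P_def Y'_def Z'_def by measurable
    have YT: "Y' i (T \<omega>) = Y i \<omega>" and ZT: "Z' i (T \<omega>) = Z i \<omega>" if "i \<in> {1..N}" for i \<omega>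
      using that by (auto simp: Y'_def Z'_def T_def)
    have D: "prob_space D" unfolding D_def by (rule prob_space_distr) (rule T)
    have ind: "independent_families D N Y' Z'"
      unfolding independent_families_def D_def
    proof (rule indep_vars_distrI[OF T])
      have "indep_vars (\<lambda>_. borel) (\<lambda>i \<omega>. case_sum Y' Z' i (T \<omega>)) ({1..N} <+> {1..N})
          \<longleftrightarrow> indep_vars (\<lambda>_. borel) (case_sum Y Z) ({1..N} <+> {1..N})"
        by (intro indep_vars_cong) (auto simp: fun_eq_iff YT ZT)
      then show "indep_vars (\<lambda>_. borel) (\<lambda>i \<omega>. case_sum Y' Z' i (T \<omega>)) ({1..N} <+> {1..N})"
        using indM by (simp add: independent_families_def)
    qed auto
    have mean: "\<forall>i\<in>{1..N}. has_bochner_integral D (Y' i) m \<and> has_bochner_integral D (Z' i) m"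
      using 1(3) unfolding D_def
      by (auto simp: has_bochner_integral_iff integrable_distr_eq integral_distr YT ZT)
    have norm: "Lp_norm D p X = Lp_norm M p (\<lambda>\<omega>. X (T \<omega>))" if "X \<in> borel_measurable P" for p X
      unfolding D_def by (rule Lp_norm_distr[OF T that])
    have dev: "\<forall>p\<ge>2. 0 \<le> \<mu> p \<and>
           (\<forall>i\<in>{1..N}. Lp_norm D p (\<lambda>\<omega>. Y' i \<omega> - m) \<le> ennreal (\<mu> p) \<and>
                       Lp_norm D p (\<lambda>\<omega>. Z' i \<omega> - m) \<le> ennreal (\<mu> p))"
      using 1(4) by (auto simp: norm YT ZT)
    have lin: "Lp_norm D p (\<lambda>x. \<Sum>i\<in>{1..N}. b i * Y' i x) = Lp_norm M p (\<lambda>\<omega>. \<Sum>i\<in>{1..N}. b i * Y i \<omega>)"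
      by (subst norm) (auto simp: YT)
    have bil: "Lp_norm D p (\<lambda>x. \<Sum>(i, j)\<in>{1..N} \<times> {1..N}. a i j * Y' i x * Z' j x)
        = Lp_norm M p (\<lambda>\<omega>. \<Sum>(i, j)\<in>{1..N} \<times> {1..N}. a i j * Y i \<omega> * Z j \<omega>)"
      by (subst norm) (auto simp: YT ZT split_def intro!: arg_cong[where f="Lp_norm M p"] sum.cong)
    have off: "Lp_norm D p (\<lambda>x. \<Sum>(i, j)\<in>{(i, j). i \<in> {1..N} \<and> j \<in> {1..N} \<and> i \<noteq> j}. a i j * Y' i x * Y' j x)
        = Lp_norm M p (\<lambda>\<omega>. \<Sum>(i, j)\<in>{(i, j). i \<in> {1..N} \<and> j \<in> {1..N} \<and> i \<noteq> j}. a i j * Y i \<omega> * Y j \<omega>)"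
      by (subst norm) (auto simp: YT split_def intro!: arg_cong[where f="Lp_norm M p"] sum.cong)
    show ?case
      using A[unfolded moment_constants_def, THEN conjunct2,
          THEN spec[where x=D], THEN spec[where x=N], THEN spec[where x=a], THEN spec[where x=b],
          THEN spec[where x=Y'], THEN spec[where x=Z'], THEN spec[where x=m], THEN spec[where x=\<mu>],
          THEN mp, OF D, THEN mp, OF ind, THEN mp, OF mean, THEN mp, OF dev,
          THEN spec[where x=p], THEN mp, OF 1(5)]
      unfolding lin bil off .
  qed
qed

theorem theorem19:
  shows "(\<exists>A. moment_constants TYPE(nat \<Rightarrow> complex) A) \<and>
         (\<forall>A. moment_constants TYPE(nat \<Rightarrow> complex) A \<longrightarrow> moment_constants TYPE('a) A)"
  using moment_constants_moment_const moment_constants_transfer by blast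

end
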